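(* If $G$ is a planar graph of girth at least five, then $\chi^\star_c(G)\le 4$. More generally, $\chi^\star_c(G)\le 4$ whenever $G$ is triangle-free and has maximum average degree less than $10/3$.
   Context: Graphs are finite and simple. The maximum average degree of $G$ is the maximum of $2|E(H)|/|V(H)|$ over all nonempty subgraphs $H$ of $G$. For a positive integer $k$, a $k$-cover of a graph $G$ is a pair $(\vec D,\sigma)$ where $\vec D$ is an orientation of $G$ and $\sigma$ assigns to each arc of $\vec D$ a permutation of $[k]$. A $(\vec D,\sigma)$-coloring is a map $\varphi:V(G)\to[k]$ with $\sigma(vw)(\varphi(v))\ne\varphi(w)$ for every arc $vw$. A $(\vec D,\sigma)$-packing is a collection $\varphi_1,\dots,\varphi_k$ of $(\vec D,\sigma)$-colorings with $\varphi_i(v)\ne\varphi_j(v)$ for every vertex $v$ and all distinct $i,j\in[k]$. $\chi^\star_c(G)$ is the minimum $k$ such that $G$ has a $(\vec D,\sigma)$-packing for every $k$-cover of $G$. *)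

theory Defs
  imports "HOL-Analysis.Analysis" "HOL-Combinatorics.Permutations" "HOL-Library.Extended_Nat"
begin

definition simple_graph :: "'a set \<Rightarrow> 'a set set \<Rightarrow> bool" where
  "simple_graph V E \<longleftrightarrow> finite V \<and> (\<forall>e\<in>E. e \<subseteq> V \<and> card e = 2)"

definition subgraph_of :: "'a set \<Rightarrow> 'a set set \<Rightarrow> 'a set \<Rightarrow> 'a set set \<Rightarrow> bool" where
  "subgraph_of W F V E \<longleftrightarrow> simple_graph W F \<and> W \<subseteq> V \<and> F \<subseteq> E"

text \<open>The graph without vertices has no nonempty subgraph; its maximum average degree
  is set to \<open>0\<close> by convention.\<close>

definition max_avg_degree :: "'a set \<Rightarrow> 'a set set \<Rightarrow> real" where
  "max_avg_degree V E =
    (if V = {} then 0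
     else Max {2 * real (card F) / real (card W) | W F. subgraph_of W F V E \<and> W \<noteq> {}})"

definition triangle_free :: "'a set set \<Rightarrow> bool" where
  "triangle_free E \<longleftrightarrow> \<not> (\<exists>x y z. {x, y} \<in> E \<and> {y, z} \<in> E \<and> {x, z} \<in> E)"

text \<open>A cycle is given by the list of its vertices, in cyclic order.\<close>

definition is_cycle :: "'a set set \<Rightarrow> 'a list \<Rightarrow> bool" where
  "is_cycle E c \<longleftrightarrow> length c \<ge> 3 \<and> distinct c \<and>
     (\<forall>i<length c. {c ! i, c ! (Suc i mod length c)} \<in> E)"

text \<open>Forests have girth \<open>\<infinity>\<close>, the infimum of the empty set.\<close>

definition girth :: "'a set set \<Rightarrow> enat" where
  "girth E = Inf {enat (length c) | c. is_cycle E c}"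

text \<open>A drawing in the plane: \<open>p\<close> places the vertices, and \<open>\<gamma> e\<close> is a simple (injective,
  continuous) arc joining the ends of the edge \<open>e\<close>, meeting no other vertex, and meeting other
  edges at vertices only.\<close>

definition plane_drawing ::
    "'a set \<Rightarrow> 'a set set \<Rightarrow> ('a \<Rightarrow> complex) \<Rightarrow> ('a set \<Rightarrow> real \<Rightarrow> complex) \<Rightarrow> bool" where
  "plane_drawing V E p \<gamma> \<longleftrightarrow>
     inj_on p V \<and>
     (\<forall>e\<in>E. arc (\<gamma> e) \<and> {pathstart (\<gamma> e), pathfinish (\<gamma> e)} = p ` e \<and>
             path_image (\<gamma> e) \<inter> p ` V = p ` e) \<and>
     (\<forall>e\<in>E. \<forall>f\<in>E. e \<noteq> f \<longrightarrow> path_image (\<gamma> e) \<inter> path_image (\<gamma> f) \<subseteq> p ` V)"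

definition planar_graph :: "'a set \<Rightarrow> 'a set set \<Rightarrow> bool" where
  "planar_graph V E \<longleftrightarrow> (\<exists>p \<gamma>. plane_drawing V E p \<gamma>)"

definition orientation_of :: "('a \<times> 'a) set \<Rightarrow> 'a set set \<Rightarrow> bool" where
  "orientation_of D E \<longleftrightarrow>
     (\<forall>(v, w)\<in>D. {v, w} \<in> E) \<and>
     (\<forall>v w. {v, w} \<in> E \<longrightarrow> ((v, w) \<in> D \<longleftrightarrow> (w, v) \<notin> D))"

definition is_cover ::
    "nat \<Rightarrow> 'a set set \<Rightarrow> ('a \<times> 'a) set \<Rightarrow> ('a \<times> 'a \<Rightarrow> nat \<Rightarrow> nat) \<Rightarrow> bool" where
  "is_cover k E D \<sigma> \<longleftrightarrow> orientation_of D E \<and> (\<forall>a\<in>D. \<sigma> a permutes {1..k})"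

definition cover_coloring ::
    "nat \<Rightarrow> 'a set \<Rightarrow> ('a \<times> 'a) set \<Rightarrow> ('a \<times> 'a \<Rightarrow> nat \<Rightarrow> nat) \<Rightarrow> ('a \<Rightarrow> nat) \<Rightarrow> bool" where
  "cover_coloring k V D \<sigma> \<phi> \<longleftrightarrow>
     (\<forall>v\<in>V. \<phi> v \<in> {1..k}) \<and> (\<forall>(v, w)\<in>D. \<sigma> (v, w) (\<phi> v) \<noteq> \<phi> w)"

definition cover_packing ::
    "nat \<Rightarrow> 'a set \<Rightarrow> ('a \<times> 'a) set \<Rightarrow> ('a \<times> 'a \<Rightarrow> nat \<Rightarrow> nat) \<Rightarrow> (nat \<Rightarrow> 'a \<Rightarrow> nat) \<Rightarrow> bool" where
  "cover_packing k V D \<sigma> \<Phi> \<longleftrightarrow>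
     (\<forall>i\<in>{1..k}. cover_coloring k V D \<sigma> (\<Phi> i)) \<and>
     (\<forall>v\<in>V. \<forall>i\<in>{1..k}. \<forall>j\<in>{1..k}. i \<noteq> j \<longrightarrow> \<Phi> i v \<noteq> \<Phi> j v)"

text \<open>The infimum in \<^typ>\<open>enat\<close> of a nonempty set of naturals is its minimum. The value \<open>\<infinity>\<close>
  for the empty set ensures that a finite upper bound is never satisfied vacuously.\<close>

definition corr_packing_number :: "'a set \<Rightarrow> 'a set set \<Rightarrow> enat" where
  "corr_packing_number V E =
     Inf {enat k | k. k \<ge> 1 \<and> (\<forall>D \<sigma>. is_cover k E D \<sigma> \<longrightarrow> (\<exists>\<Phi>. cover_packing k V D \<sigma> \<Phi>))}"

end

theory Submission
  imports Defs
begin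

text \<open>
  Colouring. At a vertex \<open>v\<close>, the colours of the four colourings form a permutation of \<open>{1..4}\<close>, and
  each coloured neighbour forbids one permutation pointwise. Two pointwise forbidden permutations can
  always be avoided, so a vertex of degree at most 2 is reducible. So is a 3-vertex with two
  3-neighbours, which are nonadjacent in a triangle-free graph: after normalising the covers along
  the two edges this is a statement about permutations of four points. If neither configuration
  occurs, every 3-vertex has at least two neighbours of degree at least 4; if each of these sends it
  1/6, all vertices end up with at least 10/3, so the average degree is at least 10/3.

  Planarity. For a plane graph of girth at least 5, \<open>3|E| + 5 \<le> 5|V|\<close> holds for every nonempty
  induced subgraph. The bound adds up along separations of order at most 1, so the graph may be
  assumed to have none. It then has an ear decomposition, and an ear splits the region it lies in
  into two regions by the Jordan curve theorem and Janiszewski's theorem. Hence there are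
  \<open>|E| - |V| + 2\<close> regions, bounded by cycles of total length \<open>2|E|\<close>, each of length at least 5.
\<close>

section \<open>Permutations of four points\<close>

text \<open>A permutation \<open>p\<close> of \<open>{1..4}\<close> is represented by the list \<open>[p 1, p 2, p 3, p 4]\<close>.\<close>

definition avoids :: "nat list \<Rightarrow> nat list \<Rightarrow> bool" where
  "avoids p q \<longleftrightarrow> list_all2 (\<noteq>) p q"

definition perms4 :: "nat list list" where
  "perms4 = filter distinct (List.n_lists 4 [1, 2, 3, 4])"

text \<open>The explicit list spares the evaluations below from filtering all 256 lists over four
  letters again and again.\<close>

lemma perms4_code [code]:
  "perms4 = [[4, 3, 2, 1], [3, 4, 2, 1], [4, 2, 3, 1], [2, 4, 3, 1], [3, 2, 4, 1], [2, 3, 4, 1],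
    [4, 3, 1, 2], [3, 4, 1, 2], [4, 1, 3, 2], [1, 4, 3, 2], [3, 1, 4, 2], [1, 3, 4, 2],
    [4, 2, 1, 3], [2, 4, 1, 3], [4, 1, 2, 3], [1, 4, 2, 3], [2, 1, 4, 3], [1, 2, 4, 3],
    [3, 2, 1, 4], [2, 3, 1, 4], [3, 1, 2, 4], [1, 3, 2, 4], [2, 1, 3, 4], [1, 2, 3, 4]]"
  unfolding perms4_def by code_simp

text \<open>In the path configuration these are the candidates at an end vertex whose two coloured
  neighbours forbid \<open>f\<close> and \<open>g\<close>.\<close>

definition joint_avoiders :: "nat list \<Rightarrow> nat list \<Rightarrow> nat list list" where
  "joint_avoiders f g = filter (\<lambda>h. avoids h f \<and> avoids h g) perms4"

text \<open>\<open>f\<close> and \<open>g\<close> are the permutations at the ends of a path with three vertices, normalised so that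
  the middle vertex has to avoid the identity besides \<open>f\<close> and \<open>g\<close>.\<close>

definition compatible :: "nat list \<Rightarrow> nat list \<Rightarrow> bool" where
  "compatible f g = list_ex (\<lambda>h. avoids h f \<and> avoids h g \<and> avoids h [1, 2, 3, 4]) perms4"

text \<open>A flexible permutation at one end of the path leaves the other end free: whatever is
  chosen there, the middle vertex can be completed.\<close>

definition flexible :: "nat list list" where
  "flexible = filter (\<lambda>f. list_all (compatible f) perms4) perms4"

text \<open>These are exactly the ten involutions of four points, the identity included.\<close>

lemma flexible_code [code]:
  "flexible = [[4, 3, 2, 1], [4, 2, 3, 1], [3, 4, 1, 2], [1, 4, 3, 2], [2, 1, 4, 3],
    [1, 2, 4, 3], [3, 2, 1, 4], [1, 3, 2, 4], [2, 1, 3, 4], [1, 2, 3, 4]]"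
  unfolding flexible_def by code_simp

text \<open>For 64 of the 576 pairs of permutations no joint avoider is flexible. They give 32 different
  sets of joint avoiders, the only ones that have to be compared pairwise.\<close>

definition rigid :: "nat list list list" where
  "rigid = remdups (filter (\<lambda>u. \<not> list_ex (List.member flexible) u)
     (concat (map (\<lambda>f. map (joint_avoiders f) perms4) perms4)))"

text \<open>Checked for all 576 pairs. Behind it is Hall's theorem: joining each index to the values
  permitted there gives a bipartite graph on 4 + 4 vertices with all degrees at least 2, and such a
  graph has a perfect matching.\<close>

lemma joint_avoiders_nonempty:
  "list_all (\<lambda>f. list_all (\<lambda>g. joint_avoiders f g \<noteq> []) perms4) perms4"
  by code_simp

text \<open>The case in which neither end has a flexible candidate: 32 * 32 comparisons of candidate
  sets instead of 576 * 576 comparisons of pairs.\<close>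

lemma rigid_compatible:
  "list_all (\<lambda>u. list_all (\<lambda>v. list_ex (\<lambda>f. list_ex (compatible f) v) u) rigid) rigid"
  by code_simp

lemma compatible_sym: "compatible f g \<longleftrightarrow> compatible g f"
  by (auto simp: compatible_def list_ex_iff)

text \<open>If one end has a flexible candidate, any candidate at the other end goes with it.
  Otherwise both candidate lists are rigid, and the table decides.\<close>

lemma joint_avoiders_compatible:
  assumes "f \<in> set perms4" "f' \<in> set perms4" "g \<in> set perms4" "g' \<in> set perms4"
  shows "\<exists>p\<in>set (joint_avoiders f f'). \<exists>r\<in>set (joint_avoiders g g'). compatible p r"
proof -
  have ne: "\<exists>h. h \<in> set (joint_avoiders k k')" if "k \<in> set perms4" "k' \<in> set perms4" for k k'
    using joint_avoiders_nonempty that by (fastforce simp: list_all_iff neq_Nil_conv)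
  have sub: "set (joint_avoiders k k') \<subseteq> set perms4" for k k'
    by (auto simp: joint_avoiders_def)
  have flex: "compatible h k" if "h \<in> set flexible" "k \<in> set perms4" for h k
    using that by (auto simp: flexible_def list_all_iff)
  have rigid: "joint_avoiders k k' \<in> set rigid"
    if "k \<in> set perms4" "k' \<in> set perms4"
      "\<not> (\<exists>h\<in>set (joint_avoiders k k'). h \<in> set flexible)" for k k'
    using that by (auto simp: rigid_def list_ex_iff)
  consider h where "h \<in> set (joint_avoiders f f')" "h \<in> set flexible"
    | h where "h \<in> set (joint_avoiders g g')" "h \<in> set flexible"
    | "joint_avoiders f f' \<in> set rigid" "joint_avoiders g g' \<in> set rigid"
    using rigid assms by blast
  then show ?thesis
  proof cases
    case 1
    then show ?thesis using ne[OF assms(3,4)] sub flex by blast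
  next
    case 2
    then show ?thesis using ne[OF assms(1,2)] sub flex compatible_sym by blast
  next
    case 3
    then show ?thesis using rigid_compatible by (fastforce simp: list_all_iff list_ex_iff)
  qed
qed

section \<open>From lists back to permutations\<close>

lemma atLeastAtMost_4: "{1..4::nat} = {1, 2, 3, 4}"
  by auto

lemma set_perms4: "xs \<in> set perms4 \<longleftrightarrow> length xs = 4 \<and> distinct xs \<and> set xs \<subseteq> {1..4}"
  by (auto simp: perms4_def set_n_lists atLeastAtMost_4)

lemma map_permutes_in_perms4:
  assumes "p permutes {1..4::nat}"
  shows "map p [1, 2, 3, 4] \<in> set perms4"
proof -
  have "inj p" using assms permutes_inj by blast
  then have "distinct (map p [1, 2, 3, 4])"
    by (simp add: inj_eq)
  moreover have "set (map p [1, 2, 3, 4]) \<subseteq> {1..4}"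
    using permutes_in_image[OF assms] by simp
  ultimately show ?thesis
    by (simp add: set_perms4)
qed

lemma perms4_imp_permutes:
  assumes "xs \<in> set perms4"
  obtains p where "p permutes {1..4::nat}" "map p [1, 2, 3, 4] = xs"
proof -
  from assms have xs: "length xs = 4" "distinct xs" "set xs \<subseteq> {1..4}" by (auto simp: set_perms4)
  \<comment> \<open>List positions start at 0, hence the shift; \<open>permutes\<close> demands the
    identity outside \<open>{1..4}\<close>.\<close>
  define p where "p i = (if i \<in> {1..4} then xs ! (i - 1) else i)" for i
  have inj: "inj_on p {1..4}"
    using xs by (auto simp: inj_on_def p_def nth_eq_iff_index_eq)
  have "p ` {1..4} \<subseteq> {1..4}"
    using xs nth_mem[of _ xs] unfolding p_def by fastforce
  then have "bij_betw p {1..4} {1..4}"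
    using inj by (simp add: bij_betw_def endo_inj_surj)
  then have "p permutes {1..4}"
    by (rule bij_imp_permutes) (auto simp: p_def)
  moreover have "map p [1, 2, 3, 4] = xs"
    using xs(1) by (auto simp: p_def numeral_eq_Suc length_Suc_conv)
  ultimately show ?thesis using that by blast
qed

lemma avoids_map:
  "avoids (map p [1, 2, 3, 4]) (map q [1, 2, 3, 4]) \<longleftrightarrow> (\<forall>i\<in>{1..4::nat}. p i \<noteq> q i)"
  unfolding avoids_def atLeastAtMost_4 by simp

lemma vertex_extension:
  assumes "f permutes {1..4::nat}" "g permutes {1..4}"
  obtains p where "p permutes {1..4}" "\<forall>i\<in>{1..4}. p i \<noteq> f i \<and> p i \<noteq> g i"
proof -
  \<comment> \<open>The statement about paths is reused, with \<open>f\<close>, \<open>f\<close> as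
    a dummy pair at the other end.\<close>
  obtain h where "h \<in> set (joint_avoiders (map f [1, 2, 3, 4]) (map g [1, 2, 3, 4]))"
    using joint_avoiders_compatible[OF map_permutes_in_perms4[OF assms(1)] map_permutes_in_perms4[OF assms(2)]
       map_permutes_in_perms4[OF assms(1)] map_permutes_in_perms4[OF assms(1)]] by blast
  then have h: "h \<in> set perms4" "avoids h (map f [1, 2, 3, 4])" "avoids h (map g [1, 2, 3, 4])"
    by (auto simp: joint_avoiders_def)
  from h(1) obtain p where p: "p permutes {1..4}" "map p [1, 2, 3, 4] = h"
    by (rule perms4_imp_permutes)
  show ?thesis
    by (rule that[of p]) (use p h avoids_map in blast)+
qed

lemma path_extension_id:
  assumes "f permutes {1..4::nat}" "f' permutes {1..4}" "g permutes {1..4}" "g' permutes {1..4}"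
  obtains p q r where "p permutes {1..4}" "q permutes {1..4}" "r permutes {1..4}"
    "\<forall>i\<in>{1..4}. p i \<noteq> f i \<and> p i \<noteq> f' i \<and> r i \<noteq> g i \<and> r i \<noteq> g' i \<and> q i \<noteq> i \<and> q i \<noteq> p i \<and> q i \<noteq> r i"
proof -
  let ?l = "\<lambda>p::nat \<Rightarrow> nat. map p [1, 2, 3, 4]"
  obtain p' r' where "p' \<in> set (joint_avoiders (?l f) (?l f'))"
    "r' \<in> set (joint_avoiders (?l g) (?l g'))"
      "compatible p' r'"
    using joint_avoiders_compatible assms map_permutes_in_perms4 by blast
  then obtain q' where pqr: "p' \<in> set perms4" "q' \<in> set perms4" "r' \<in> set perms4"
     "avoids p' (?l f)" "avoids p' (?l f')" "avoids r' (?l g)" "avoids r' (?l g')"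
     "avoids q' p'" "avoids q' r'" "avoids q' (?l (\<lambda>i. i))"
    by (auto simp: joint_avoiders_def compatible_def list_ex_iff)
  from pqr obtain p q r where perm: "p permutes {1..4}" "q permutes {1..4}" "r permutes {1..4}"
    and eq: "p' = ?l p" "q' = ?l q" "r' = ?l r"
    by (metis perms4_imp_permutes)
  have "\<forall>i\<in>{1..4}. p i \<noteq> f i \<and> p i \<noteq> f' i \<and> r i \<noteq> g i \<and> r i \<noteq> g' i \<and> q i \<noteq> i \<and> q i \<noteq> p i \<and> q i \<noteq> r i"
    using pqr(4-) unfolding eq avoids_map by blast
  with perm that show ?thesis by blast
qed

text \<open>Renaming colours at the three vertices reduces this to \<open>path_extension_id\<close>:
  values at the middle are read through \<open>inv b\<close>, values at the ends through
  \<open>inv b \<circ> s\<close> and \<open>inv b \<circ> t\<close>. Then both edges carry the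
  identity, and so does the permutation forbidden at the middle. The witnesses \<open>P\<close>,
  \<open>b \<circ> q\<close> and \<open>R\<close> undo the renaming.\<close>

lemma path_extension:
  assumes "f permutes {1..4::nat}" "f' permutes {1..4}" "b permutes {1..4}"
    "g permutes {1..4}" "g' permutes {1..4}" "s permutes {1..4}" "t permutes {1..4}"
  obtains p q r where "p permutes {1..4}" "q permutes {1..4}" "r permutes {1..4}"
    "\<forall>i\<in>{1..4}. p i \<noteq> f i \<and> p i \<noteq> f' i \<and> r i \<noteq> g i \<and> r i \<noteq> g' i \<and> q i \<noteq> b i \<and> s (p i) \<noteq> q i \<and> t (r i) \<noteq> q i"
proof -
  let ?u = "inv b \<circ> s" and ?w = "inv b \<circ> t"
  have u: "?u permutes {1..4}" and w: "?w permutes {1..4}"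
    using assms by (auto intro: permutes_compose permutes_inv)
  obtain p q r where p: "p permutes {1..4}" and q: "q permutes {1..4}" and r: "r permutes {1..4}"
    and *: "\<forall>i\<in>{1..4}. p i \<noteq> (?u \<circ> f) i \<and> p i \<noteq> (?u \<circ> f') i \<and> r i \<noteq> (?w \<circ> g) i \<and> r i \<noteq> (?w \<circ> g') i \<and>
      q i \<noteq> i \<and> q i \<noteq> p i \<and> q i \<noteq> r i"
    by (rule path_extension_id[OF permutes_compose[OF assms(1) u] permutes_compose[OF assms(2) u]
      permutes_compose[OF assms(4) w] permutes_compose[OF assms(5) w]])
  define P where "P = inv s \<circ> (b \<circ> p)"
  define R where "R = inv t \<circ> (b \<circ> r)"
  have perm: "P permutes {1..4}" "(b \<circ> q) permutes {1..4}" "R permutes {1..4}"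
    using p q r assms unfolding P_def R_def by (auto intro: permutes_compose permutes_inv)
  have sP: "s (P i) = b (p i)" and tR: "t (R i) = b (r i)" for i
    using permutes_inverses[OF assms(6)] permutes_inverses[OF assms(7)]
    by (simp_all add: P_def R_def)
  have ib: "inv b (b x) = x" for x
    using permutes_inverses[OF assms(3)] by blast
  have "P i \<noteq> f i \<and> P i \<noteq> f' i \<and> R i \<noteq> g i \<and> R i \<noteq> g' i \<and> (b \<circ> q) i \<noteq> b i \<and>
      s (P i) \<noteq> (b \<circ> q) i \<and> t (R i) \<noteq> (b \<circ> q) i" if "i \<in> {1..4}" for i
  proof -
    have u: "P i = k i \<Longrightarrow> p i = (?u \<circ> k) i" for k
      using sP[of i] by (simp add: ib)
    have w: "R i = k i \<Longrightarrow> r i = (?w \<circ> k) i" for k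
      using tR[of i] by (simp add: ib)
    have inj: "b x = b y \<longleftrightarrow> x = y" for x y
      by (metis ib)
    show ?thesis
      using *[rule_format, OF that] u[of f] u[of f'] w[of g] w[of g']
      unfolding sP tR comp_apply[of b] inj by argo
  qed
  then show ?thesis using that[OF perm] by blast
qed

section \<open>Reducible configurations\<close>

text \<open>The handshake lemma for an induced subgraph: incidences of vertices and edges are
  counted in two ways.\<close>

lemma sum_degrees:
  assumes fin: "finite W" and E: "\<And>e. e \<in> E \<Longrightarrow> card e = 2"
  shows "(\<Sum>v\<in>W. card {w \<in> W. {v, w} \<in> E}) = 2 * card {e \<in> E. e \<subseteq> W}"
proof -
  let ?F = "{e \<in> E. e \<subseteq> W}"
  have finF: "finite ?F" using fin by (intro finite_subset[of ?F "Pow W"]) auto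
  have "card {w \<in> W. {v, w} \<in> E} = card {e \<in> ?F. v \<in> e}" if v: "v \<in> W" for v
  proof (rule bij_betw_same_card[of "\<lambda>w. {v, w}"], unfold bij_betw_def, intro conjI)
    show "inj_on (\<lambda>w. {v, w}) {w \<in> W. {v, w} \<in> E}"
      by (auto simp: inj_on_def doubleton_eq_iff)
    show "(\<lambda>w. {v, w}) ` {w \<in> W. {v, w} \<in> E} = {e \<in> ?F. v \<in> e}"
    proof (intro equalityI subsetI)
      fix e assume e: "e \<in> {e \<in> ?F. v \<in> e}"
      then have "card e = 2" using E by blast
      then obtain w where "e = {v, w}" using e by (auto simp: card_2_iff)
      then show "e \<in> (\<lambda>w. {v, w}) ` {w \<in> W. {v, w} \<in> E}" using e by auto
    qed (use v in auto)
  qed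
  then have "(\<Sum>v\<in>W. card {w \<in> W. {v, w} \<in> E}) = (\<Sum>v\<in>W. card {e \<in> ?F. v \<in> e})"
    by (rule sum.cong[OF refl])
  also have "\<dots> = 2 * card ?F"
  proof (rule sum_multicount[OF fin finF], intro ballI)
    fix e assume "e \<in> ?F"
    then have "{i \<in> W. i \<in> e} = e" "card e = 2" using E by auto
    then show "card {i \<in> W. i \<in> e} = 2" by simp
  qed
  finally show ?thesis .
qed

text \<open>Sparsity says that the subgraph induced on \<open>W\<close> has average degree less than
  10/3. If neither outcome occurs, all degrees are at least 3 and a 3-vertex has at most one
  3-neighbour, and discharging contradicts sparsity.\<close>

lemma sparse_reducible:
  assumes fin: "finite W" and E: "\<And>e. e \<in> E \<Longrightarrow> card e = 2"
    and sparse: "3 * card {e \<in> E. e \<subseteq> W} < 5 * card W"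
  defines "N \<equiv> \<lambda>v. {w \<in> W. {v, w} \<in> E}"
  obtains (first) v where "v \<in> W" "card (N v) \<le> 2"
  | (second) u v w where "v \<in> W" "card (N v) = 3" "u \<in> N v" "w \<in> N v" "u \<noteq> w" "card (N u) = 3"
    "card (N w) = 3"
proof (rule ccontr)
  assume "\<not> thesis"
  have big: "card (N v) \<ge> 3" if "v \<in> W" for v
  proof (rule ccontr)
    assume "\<not> card (N v) \<ge> 3"
    then have "card (N v) \<le> 2" by simp
    then show False using first[OF \<open>v \<in> W\<close>] \<open>\<not> thesis\<close> by blast
  qed
  have few: "u = w" if "v \<in> W" "card (N v) = 3" "u \<in> N v" "w \<in> N v" "card (N u) = 3"
    "card (N w) = 3" for u v w
    using second[OF that(1-4) _ that(5,6)] \<open>\<not> thesis\<close> by blast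
  define T where "T = {v \<in> W. card (N v) = 3}"
  define B where "B = W - T"
  have finTB: "finite T" "finite B" using fin by (auto simp: T_def B_def)
  have finN: "finite (N v)" for v using fin by (simp add: N_def)
  have sumW: "(\<Sum>v\<in>W. card (N v)) = 3 * card T + (\<Sum>v\<in>B. card (N v))"
    using sum.subset_diff[of T W "\<lambda>v. card (N v)"] fin by (auto simp: B_def T_def)
  have B4: "4 * card B \<le> (\<Sum>v\<in>B. card (N v))"
  proof -
    have "4 \<le> card (N v)" if "v \<in> B" for v
      using that big[of v] by (force simp: B_def T_def)
    then show ?thesis using sum_bounded_below[of B 4 "\<lambda>v. card (N v)"] by (simp add: mult.commute)
  qed
  \<comment> \<open>Discharging in integral form: every vertex of \<open>T\<close> takes 1/6 from each of its neighbours in \<open>B\<close>.\<close>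
  have "2 * card T \<le> (\<Sum>t\<in>T. card {b \<in> B. {t, b} \<in> E})"
  proof -
    have "2 \<le> card {b \<in> B. {t, b} \<in> E}" if t: "t \<in> T" for t
    proof -
      have "N t = (N t \<inter> T) \<union> {b \<in> B. {t, b} \<in> E}" by (auto simp: N_def B_def T_def)
      then have "card (N t) \<le> card (N t \<inter> T) + card {b \<in> B. {t, b} \<in> E}" by (metis card_Un_le)
      moreover have "card (N t \<inter> T) \<le> 1"
        using few[of t] t card_le_Suc0_iff_eq[of "N t \<inter> T"] finN by (auto simp: T_def)
      moreover have "card (N t) = 3" using t by (simp add: T_def)
      ultimately show ?thesis by linarith
    qed
    then show ?thesis
      using sum_bounded_below[of T 2 "\<lambda>t. card {b \<in> B. {t, b} \<in> E}"] by (simp add: mult.commute)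
  qed
  also have "\<dots> = (\<Sum>b\<in>B. card {t \<in> T. {t, b} \<in> E})"
    by (rule sum_multicount_gen) (use finTB in auto)
  also have "\<dots> \<le> (\<Sum>b\<in>B. card (N b))"
    by (intro sum_mono card_mono finN) (auto simp: N_def T_def insert_commute)
  finally have "2 * card T \<le> (\<Sum>b\<in>B. card (N b))" .
  moreover have "card W = card T + card B"
    using card_Un_disjoint[of T B] finTB by (auto simp: B_def T_def Un_absorb1)
  moreover have "(\<Sum>v\<in>W. card (N v)) = 2 * card {e \<in> E. e \<subseteq> W}"
    unfolding N_def by (rule sum_degrees[OF fin E])
  \<comment> \<open>Let \<open>S\<close> be the degree sum over \<open>B\<close>. From
    \<open>S \<ge> 2 * card T\<close> and \<open>S \<ge> 4 * card B\<close> follows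
    \<open>3 * S \<ge> card T + 10 * card B\<close>. Hence three times the degree sum over
    \<open>W\<close> is at least \<open>10 * card W\<close>, while sparsity makes it
    smaller.\<close>
  ultimately show False using sumW B4 sparse by linarith
qed

text \<open>Reads the cover along an edge in either direction, with the inverse permutation against
  the arc, so that the later arguments need not look at the orientation.\<close>

definition transport :: "('a \<times> 'a) set \<Rightarrow> ('a \<times> 'a \<Rightarrow> nat \<Rightarrow> nat) \<Rightarrow> 'a \<Rightarrow> 'a \<Rightarrow> nat \<Rightarrow> nat" where
  "transport D \<sigma> v w = (if (v, w) \<in> D then \<sigma> (v, w) else inv (\<sigma> (w, v)))"

text \<open>\<open>\<Phi> v\<close> sends the index of a colouring to the colour that this colouring gives to \<open>v\<close>.\<close>

definition packs :: "'a set set \<Rightarrow> ('a \<times> 'a) set \<Rightarrow> ('a \<times> 'a \<Rightarrow> nat \<Rightarrow> nat) \<Rightarrow> ('a \<Rightarrow> nat \<Rightarrow> nat) \<Rightarrow> 'a set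
  \<Rightarrow> bool" where
  "packs E D \<sigma> \<Phi> W \<longleftrightarrow> (\<forall>v\<in>W. \<Phi> v permutes {1..4}) \<and>
     (\<forall>v\<in>W. \<forall>w\<in>W. {v, w} \<in> E \<longrightarrow> (\<forall>i\<in>{1..4}. transport D \<sigma> v w (\<Phi> v i) \<noteq> \<Phi> w i))"

lemma transport_permutes:
  assumes "is_cover 4 E D \<sigma>" "{v, w} \<in> E"
  shows "transport D \<sigma> v w permutes {1..4}"
proof -
  have "(v, w) \<in> D \<or> (w, v) \<in> D"
    using assms by (auto simp: is_cover_def orientation_of_def)
  then show ?thesis
    using assms(1) by (auto simp: is_cover_def transport_def intro: permutes_inv)
qed

lemma transport_transport:
  assumes "is_cover 4 E D \<sigma>" "{v, w} \<in> E"
  shows "transport D \<sigma> w v (transport D \<sigma> v w x) = x"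
proof -
  have D: "(v, w) \<in> D \<longleftrightarrow> (w, v) \<notin> D"
    using assms by (simp add: is_cover_def orientation_of_def)
  show ?thesis
  proof (cases "(v, w) \<in> D")
    case True
    then have "\<sigma> (v, w) permutes {1..4}" using assms(1) by (auto simp: is_cover_def)
    from permutes_inverses(2)[OF this] show ?thesis using True D by (simp add: transport_def)
  next
    case False
    then have "\<sigma> (w, v) permutes {1..4}" using assms(1) D by (auto simp: is_cover_def)
    from permutes_inverses(1)[OF this] show ?thesis using False D by (simp add: transport_def)
  qed
qed

text \<open>Only edges at \<open>v\<close> bring new constraints. It suffices to check them towards
  \<open>v\<close>, because the transports in the two directions are mutually inverse.\<close>

lemma packs_insert:
  assumes cov: "is_cover 4 E D \<sigma>" and E: "\<And>e. e \<in> E \<Longrightarrow> card e = 2"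
    and W: "packs E D \<sigma> \<Phi> W" "v \<notin> W" "p permutes {1..4}"
    and new: "\<And>w i. \<lbrakk>w \<in> W; {v, w} \<in> E; i \<in> {1..4}\<rbrakk> \<Longrightarrow> transport D \<sigma> w v (\<Phi> w i) \<noteq> p i"
  shows "packs E D \<sigma> (\<Phi>(v := p)) (insert v W)"
proof -
  have "transport D \<sigma> x y ((\<Phi>(v := p)) x i) \<noteq> (\<Phi>(v := p)) y i"
    if xy: "x \<in> insert v W" "y \<in> insert v W" "{x, y} \<in> E" and i: "i \<in> {1..4}" for x y i
  proof -
    have "x \<noteq> y" using E[OF xy(3)] by auto
    then consider "x \<in> W" "y \<in> W" | "x = v" "y \<in> W" | "x \<in> W" "y = v" using xy by blast
    then show ?thesis
    proof cases
      case 1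
      then show ?thesis using W xy(3) i by (auto simp: packs_def)
    next
      case 2
      have "transport D \<sigma> v y (p i) \<noteq> \<Phi> y i"
        using new[of y i] 2 xy(3) i transport_transport[OF cov, of v y "p i"] by auto
      then show ?thesis using 2 W(2) by auto
    next
      case 3
      then show ?thesis using new[of x i] W(2) xy(3) i by (auto simp: insert_commute)
    qed
  qed
  then show ?thesis
    using W(1,3) unfolding packs_def by simp
qed

text \<open>Pads a family of at most two forbidden permutations to exactly two, the form in which
  the extension lemmas expect them.\<close>

lemma two_forbidden_permutations:
  assumes "finite N" "card N \<le> 2" "\<And>y. y \<in> N \<Longrightarrow> h y permutes S"
  obtains f g where "f permutes S" "g permutes S" "\<And>y. y \<in> N \<Longrightarrow> h y = f \<or> h y = g"
proof -
  consider "N = {}" | a where "N = {a}" | a b where "N = {a, b}"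
  proof -
    have "card N = 0 \<or> card N = 1 \<or> card N = 2" using assms(2) by linarith
    then show ?thesis using that assms(1) by (auto simp: card_1_singleton_iff card_2_iff)
  qed
  then show ?thesis
  proof cases
    case 1
    then show ?thesis using that[of id id] permutes_id by blast
  next
    case (2 a)
    then show ?thesis using that[of "h a" "h a"] assms(3) by blast
  next
    case (3 a b)
    then show ?thesis using that[of "h a" "h b"] assms(3) by blast
  qed
qed

lemma one_forbidden_permutation:
  assumes "finite N" "card N \<le> 1" "\<And>y. y \<in> N \<Longrightarrow> h y permutes S"
  obtains f where "f permutes S" "\<And>y. y \<in> N \<Longrightarrow> h y = f"
proof (cases "N = {}")
  case True
  then show ?thesis using that[of id] permutes_id by blast
next
  case False
  then obtain a where "N = {a}"
    using assms(1,2) by (metis card_0_eq card_1_singletonE le_antisym less_one not_le)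
  then show ?thesis using that[of "h a"] assms(3) by blast
qed

text \<open>Induction on the number of vertices: a reducible configuration is removed, the rest is
  packed, and the packing is extended. Since sparsity holds for every nonempty subset, such a
  configuration exists at each stage.\<close>

lemma sparse_packs:
  assumes G: "simple_graph V E" and tri: "triangle_free E"
    and sparse: "\<And>W. \<lbrakk>W \<subseteq> V; W \<noteq> {}\<rbrakk> \<Longrightarrow> 3 * card {e \<in> E. e \<subseteq> W} < 5 * card W"
    and cov: "is_cover 4 E D \<sigma>" and "W \<subseteq> V"
  shows "\<exists>\<Phi>. packs E D \<sigma> \<Phi> W"
  using \<open>W \<subseteq> V\<close>
proof (induction "card W" arbitrary: W rule: less_induct)
  case less
  have E: "card e = 2" if "e \<in> E" for e using G that by (simp add: simple_graph_def)
  have finW: "finite W" using G less.prems finite_subset by (auto simp: simple_graph_def)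
  define N where "N v = {w \<in> W. {v, w} \<in> E}" for v
  have finN: "finite (N v)" for v using finW by (simp add: N_def)
  have loop: "{v, v} \<notin> E" for v using E[of "{v, v}"] by auto
  let ?t = "transport D \<sigma>"
  show ?case
  proof (cases "W = {}")
    case True
    then show ?thesis by (auto simp: packs_def)
  next
    case False
    from finW E sparse[OF less.prems False] consider
        (small) v where "v \<in> W" "card (N v) \<le> 2"
      | (path) u v w where "v \<in> W" "card (N v) = 3" "u \<in> N v" "w \<in> N v" "u \<noteq> w" "card (N u) = 3"
        "card (N w) = 3"
      unfolding N_def by (rule sparse_reducible)
    then show ?thesis
    proof cases
      case small
      have "card (W - {v}) < card W" using finW small(1) by (rule card_Diff1_less)
      then obtain \<Phi> where \<Phi>: "packs E D \<sigma> \<Phi> (W - {v})"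
        using less.hyps[of "W - {v}"] less.prems by blast
      have perm: "(?t y v \<circ> \<Phi> y) permutes {1..4}" if "y \<in> N v" for y
      proof (rule permutes_compose)
        have "y \<in> W - {v}" "{y, v} \<in> E" using that loop by (auto simp: N_def insert_commute)
        then show "\<Phi> y permutes {1..4}" "?t y v permutes {1..4}"
          using \<Phi> transport_permutes[OF cov] by (auto simp: packs_def)
      qed
      obtain f g where fg: "f permutes {1..4}" "g permutes {1..4}"
        "\<And>y. y \<in> N v \<Longrightarrow> ?t y v \<circ> \<Phi> y = f \<or> ?t y v \<circ> \<Phi> y = g"
        by (rule two_forbidden_permutations[OF finN small(2), of "\<lambda>y. ?t y v \<circ> \<Phi> y" "{1..4}"])
          (use perm in blast)+
      obtain p where p: "p permutes {1..4}" "\<forall>i\<in>{1..4}. p i \<noteq> f i \<and> p i \<noteq> g i"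
        by (rule vertex_extension[OF fg(1,2)])
      have "packs E D \<sigma> (\<Phi>(v := p)) (insert v (W - {v}))"
      proof (rule packs_insert[OF cov E \<Phi> _ p(1)])
        fix y i assume y: "y \<in> W - {v}" "{v, y} \<in> E" "i \<in> {1..4::nat}"
        then have "?t y v \<circ> \<Phi> y = f \<or> ?t y v \<circ> \<Phi> y = g" using fg(3) by (auto simp: N_def)
        then have "?t y v (\<Phi> y i) = f i \<or> ?t y v (\<Phi> y i) = g i" by (metis comp_apply)
        then show "?t y v (\<Phi> y i) \<noteq> p i" using p(2) y(3) by metis
      qed auto
      then show ?thesis using small(1) by (metis insert_Diff)
    next
      case path
      let ?W = "W - {u, v, w}"
      have uvw: "u \<in> W" "w \<in> W" "{v, u} \<in> E" "{v, w} \<in> E" "u \<noteq> v" "w \<noteq> v"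
        using path loop by (auto simp: N_def)
      \<comment> \<open>Triangle-freeness enters here: without an edge between the two ends, their
        permutations constrain each other only through \<open>v\<close>.\<close>
      have uw: "{u, w} \<notin> E"
      proof
        assume "{u, w} \<in> E"
        moreover have "{u, v} \<in> E" using uvw(3) by (simp add: insert_commute)
        ultimately show False using tri uvw(4) unfolding triangle_free_def by blast
      qed
      have "card ?W < card W" using finW path(1) by (intro psubset_card_mono) auto
      then obtain \<Phi> where \<Phi>: "packs E D \<sigma> \<Phi> ?W"
        using less.hyps[of ?W] less.prems by blast
      have perm: "(?t y x \<circ> \<Phi> y) permutes {1..4}" if "y \<in> N x - {u, v, w}" for x y
      proof (rule permutes_compose)
        have "y \<in> ?W" "{y, x} \<in> E" using that by (auto simp: N_def insert_commute)
        then show "\<Phi> y permutes {1..4}" "?t y x permutes {1..4}"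
          using \<Phi> transport_permutes[OF cov] by (auto simp: packs_def)
      qed
      \<comment> \<open>Each end loses the neighbour \<open>v\<close> and keeps at most two coloured
        ones; the middle loses both ends and keeps at most one.\<close>
      have Nu: "card (N u - {u, v, w}) \<le> 2" and Nw: "card (N w - {u, v, w}) \<le> 2"
        and Nv: "card (N v - {u, v, w}) \<le> 1"
      proof -
        have "v \<in> N u" "v \<in> N w" using uvw path(1) by (auto simp: N_def insert_commute)
        then have "card (N u - {v}) = 2" "card (N w - {v}) = 2"
          using path(6,7) finN by simp_all
        then show "card (N u - {u, v, w}) \<le> 2" "card (N w - {u, v, w}) \<le> 2"
          using card_mono[of "N u - {v}" "N u - {u, v, w}"] card_mono[of "N w - {v}"
          "N w - {u, v, w}"] finN by auto
        have "card (N v - {u, w}) = 1"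
          using path(2-5) finN card_Diff_subset[of "{u, w}" "N v"] by simp
        then show "card (N v - {u, v, w}) \<le> 1"
          using card_mono[of "N v - {u, w}" "N v - {u, v, w}"] finN by auto
      qed
      obtain f f' where f: "f permutes {1..4}" "f' permutes {1..4}"
          "\<And>y. y \<in> N u - {u, v, w} \<Longrightarrow> ?t y u \<circ> \<Phi> y = f \<or> ?t y u \<circ> \<Phi> y = f'"
        by (rule two_forbidden_permutations[OF finite_Diff[OF finN] Nu, of "\<lambda>y. ?t y u \<circ> \<Phi> y"
        "{1..4}"])
          (use perm in blast)+
      obtain g g' where g: "g permutes {1..4}" "g' permutes {1..4}"
          "\<And>y. y \<in> N w - {u, v, w} \<Longrightarrow> ?t y w \<circ> \<Phi> y = g \<or> ?t y w \<circ> \<Phi> y = g'"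
        by (rule two_forbidden_permutations[OF finite_Diff[OF finN] Nw, of "\<lambda>y. ?t y w \<circ> \<Phi> y"
        "{1..4}"])
          (use perm in blast)+
      obtain b where b: "b permutes {1..4}" "\<And>y. y \<in> N v - {u, v, w} \<Longrightarrow> ?t y v \<circ> \<Phi> y = b"
        by (rule one_forbidden_permutation[OF finite_Diff[OF finN] Nv, of "\<lambda>y. ?t y v \<circ> \<Phi> y"
        "{1..4}"])
          (use perm in blast)+
      have tu: "?t u v permutes {1..4}" and tw: "?t w v permutes {1..4}"
        using transport_permutes[OF cov] uvw by (simp_all add: insert_commute)
      obtain p q r where p: "p permutes {1..4}" and q: "q permutes {1..4}"
        and r: "r permutes {1..4}"
        and pqr: "\<forall>i\<in>{1..4}. p i \<noteq> f i \<and> p i \<noteq> f' i \<and> r i \<noteq> g i \<and> r i \<noteq> g' i \<and> q i \<noteq> b i \<and>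
          ?t u v (p i) \<noteq> q i \<and> ?t w v (r i) \<noteq> q i"
        by (rule path_extension[OF f(1,2) b(1) g(1,2) tu tw])
      \<comment> \<open>The three permutations have been chosen together. They are now entered one
        at a time, the ends first, so that the edges of the path are checked when \<open>v\<close>
        is entered.\<close>
      have 1: "packs E D \<sigma> (\<Phi>(u := p)) (insert u ?W)"
      proof (rule packs_insert[OF cov E \<Phi> _ p])
        fix y i assume y: "y \<in> ?W" "{u, y} \<in> E" "i \<in> {1..4::nat}"
        then have "?t y u \<circ> \<Phi> y = f \<or> ?t y u \<circ> \<Phi> y = f'" using f(3) by (auto simp: N_def)
        then have "?t y u (\<Phi> y i) = f i \<or> ?t y u (\<Phi> y i) = f' i" by (metis comp_apply)
        then show "?t y u (\<Phi> y i) \<noteq> p i" using pqr y(3) by metis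
      qed auto
      have 2: "packs E D \<sigma> (\<Phi>(u := p, w := r)) (insert w (insert u ?W))"
      proof (rule packs_insert[OF cov E 1 _ r])
        fix y i assume y: "y \<in> insert u ?W" "{w, y} \<in> E" "i \<in> {1..4::nat}"
        have "y \<noteq> u" using y(2) uw by (auto simp: insert_commute)
        then have "?t y w \<circ> \<Phi> y = g \<or> ?t y w \<circ> \<Phi> y = g'" using g(3) y by (auto simp: N_def)
        then have "?t y w (\<Phi> y i) = g i \<or> ?t y w (\<Phi> y i) = g' i" by (metis comp_apply)
        then have "?t y w (\<Phi> y i) \<noteq> r i" using pqr y(3) by metis
        then show "?t y w ((\<Phi>(u := p)) y i) \<noteq> r i" using \<open>y \<noteq> u\<close> by simp
      qed (use path(5) in auto)
      have 3: "packs E D \<sigma> (\<Phi>(u := p, w := r, v := q)) (insert v (insert w (insert u ?W)))"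
      proof (rule packs_insert[OF cov E 2 _ q])
        fix y i assume y: "y \<in> insert w (insert u ?W)" "{v, y} \<in> E" "i \<in> {1..4::nat}"
        consider "y = w" | "y = u" | "y \<in> ?W" using y by blast
        then show "?t y v ((\<Phi>(u := p, w := r)) y i) \<noteq> q i"
        proof cases
          case 1
          then show ?thesis using pqr y(3) by simp
        next
          case 2
          then show ?thesis using pqr y(3) path(5) by simp
        next
          case 3
          then have "?t y v \<circ> \<Phi> y = b" using b(2) y by (auto simp: N_def)
          then have "?t y v (\<Phi> y i) = b i" by (metis comp_apply)
          then have "?t y v (\<Phi> y i) \<noteq> q i" using pqr y(3) by metis
          moreover have "y \<noteq> u" "y \<noteq> w" using 3 by auto
          ultimately show ?thesis by simp
        qed
      qed (use uvw in auto)
      moreover have "insert v (insert w (insert u ?W)) = W" using path(1) uvw by auto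
      ultimately show ?thesis by auto
    qed
  qed
qed

section \<open>From sparsity to the packing number, and sufficient conditions for sparsity\<close>

lemma corr_packing_number_le_4:
  assumes G: "simple_graph V E" and tri: "triangle_free E"
    and sparse: "\<And>W. \<lbrakk>W \<subseteq> V; W \<noteq> {}\<rbrakk> \<Longrightarrow> 3 * card {e \<in> E. e \<subseteq> W} < 5 * card W"
  shows "corr_packing_number V E \<le> 4"
proof -
  have "\<exists>\<Phi>. cover_packing 4 V D \<sigma> \<Phi>" if cov: "is_cover 4 E D \<sigma>" for D \<sigma>
  proof -
    obtain \<Phi> where \<Phi>: "packs E D \<sigma> \<Phi> V"
      using sparse_packs[OF G tri sparse cov subset_refl] by blast
    have perm: "\<Phi> v permutes {1..4}" if "v \<in> V" for v using \<Phi> that by (simp add: packs_def)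
    have "cover_coloring 4 V D \<sigma> (\<lambda>v. \<Phi> v i)" if i: "i \<in> {1..4}" for i
      unfolding cover_coloring_def
    proof (intro conjI ballI)
      fix v assume "v \<in> V"
      then show "\<Phi> v i \<in> {1..4}" using permutes_in_image[OF perm] i by blast
    next
      fix a assume "a \<in> D"
      then obtain v w where a: "a = (v, w)" "(v, w) \<in> D" "{v, w} \<in> E"
        using cov by (cases a) (auto simp: is_cover_def orientation_of_def)
      then have "v \<in> V" "w \<in> V" using G by (auto simp: simple_graph_def)
      then have "transport D \<sigma> v w (\<Phi> v i) \<noteq> \<Phi> w i" using \<Phi> a i by (auto simp: packs_def)
      then show "case a of (v, w) \<Rightarrow> \<sigma> (v, w) (\<Phi> v i) \<noteq> \<Phi> w i" using a by (simp add: transport_def)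
    qed
    moreover have "\<Phi> v i \<noteq> \<Phi> v j" if "v \<in> V" "i \<noteq> j" for v i j
      using permutes_inj[OF perm[OF that(1)]] that(2) by (auto dest: injD)
    ultimately have "cover_packing 4 V D \<sigma> (\<lambda>i v. \<Phi> v i)"
      unfolding cover_packing_def by blast
    then show ?thesis by blast
  qed
  then have "enat 4 \<in> {enat k | k. k \<ge> 1 \<and> (\<forall>D \<sigma>. is_cover k E D \<sigma> \<longrightarrow> (\<exists>\<Phi>. cover_packing k V D \<sigma> \<Phi>))}"
    by force
  then have "corr_packing_number V E \<le> enat 4"
    unfolding corr_packing_number_def by (rule Inf_lower)
  then show ?thesis by (simp add: numeral_eq_enat)
qed

lemma sparse_if_max_avg_degree:
  assumes G: "simple_graph V E" and mad: "max_avg_degree V E < 10 / 3" and W: "W \<subseteq> V" "W \<noteq> {}"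
  shows "3 * card {e \<in> E. e \<subseteq> W} < 5 * card W"
proof -
  let ?S = "{2 * real (card F) / real (card W) | W F. subgraph_of W F V E \<and> W \<noteq> {}}"
  have finV: "finite V" using G by (simp add: simple_graph_def)
  then have finE: "finite E"
    using G by (intro finite_subset[of E "Pow V"]) (auto simp: simple_graph_def)
  \<comment> \<open>\<open>Max\<close> bounds the members of a set only if the set is
    finite.\<close>
  have "?S \<subseteq> (\<lambda>(W, F). 2 * real (card F) / real (card W)) ` (Pow V \<times> Pow E)"
    by (auto simp: subgraph_of_def)
  then have "finite ?S" using finV finE finite_subset by blast
  moreover have "subgraph_of W {e \<in> E. e \<subseteq> W} V E"
    using G W finite_subset[OF W(1) finV] by (auto simp: subgraph_of_def simple_graph_def)
  then have "2 * real (card {e \<in> E. e \<subseteq> W}) / real (card W) \<in> ?S" using W(2) by blast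
  ultimately have "2 * real (card {e \<in> E. e \<subseteq> W}) / real (card W) \<le> Max ?S"
    by (rule Max_ge)
  \<comment> \<open>With \<open>W\<close> also \<open>V\<close> is nonempty, so the convention for
    the empty graph does not apply.\<close>
  also have "\<dots> = max_avg_degree V E" using W by (auto simp: max_avg_degree_def)
  also have "\<dots> < 10 / 3" by (rule mad)
  finally have *: "2 * real (card {e \<in> E. e \<subseteq> W}) / real (card W) < 10 / 3" .
  have "card W > 0" using W finite_subset[OF W(1) finV] by (simp add: card_gt_0_iff)
  with * have "3 * real (card {e \<in> E. e \<subseteq> W}) < 5 * real (card W)" by (simp add: field_simps)
  then show ?thesis by linarith
qed

lemma triangle_free_if_girth:
  assumes G: "simple_graph V E" and "girth E \<ge> 5"
  shows "triangle_free E"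
  unfolding triangle_free_def
proof
  assume "\<exists>x y z. {x, y} \<in> E \<and> {y, z} \<in> E \<and> {x, z} \<in> E"
  then obtain x y z where xyz: "{x, y} \<in> E" "{y, z} \<in> E" "{x, z} \<in> E" by blast
  have loop: "{v, v} \<notin> E" for v using G by (auto simp: simple_graph_def)
  then have "x \<noteq> y" "y \<noteq> z" "x \<noteq> z" using xyz by auto
  moreover have "{[x, y, z] ! i, [x, y, z] ! (Suc i mod length [x, y, z])} \<in> E"
    if i: "i < length [x, y, z]" for i
  proof -
    consider "i = 0" | "i = 1" | "i = 2" using i by fastforce
    then show ?thesis by cases (use xyz in \<open>simp_all add: insert_commute\<close>)
  qed
  ultimately have "is_cycle E [x, y, z]" unfolding is_cycle_def by simp
  then have "girth E \<le> enat (length [x, y, z])" unfolding girth_def by (blast intro: Inf_lower)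
  then have "5 \<le> enat (length [x, y, z])" using assms(2) by (rule order_trans[rotated])
  then show False by (simp add: numeral_eq_enat)
qed

section \<open>Theta curves\<close>

text \<open>The Jordan curve theorem for a closed curve made of two arcs. The names inside and
  outside are dropped, since the theta arguments treat both regions alike.\<close>

lemma Jordan_two_arcs:
  fixes c1 c2 :: "real \<Rightarrow> complex"
  assumes "arc c1" "arc c2" "pathstart c1 = a" "pathfinish c1 = b" "pathstart c2 = a"
    "pathfinish c2 = b"
    and "path_image c1 \<inter> path_image c2 = {a, b}"
  obtains X Y where "components (- (path_image c1 \<union> path_image c2)) = {X, Y}" "X \<noteq> Y"
    "frontier X = path_image c1 \<union> path_image c2" "frontier Y = path_image c1 \<union> path_image c2"
proof -
  let ?K = "path_image c1 \<union> path_image c2"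
  let ?c = "c1 +++ reversepath c2"
  have c: "simple_path ?c" "pathfinish ?c = pathstart ?c" and im: "path_image ?c = ?K"
    using assms by (auto intro!: simple_path_join_loop simp: arc_reversepath path_image_join)
  note J = Jordan_inside_outside[OF c, unfolded im]
  have io: "inside ?K \<in> components (- ?K)" "outside ?K \<in> components (- ?K)"
    unfolding inside_in_components outside_in_components using J by auto
  have "components (- ?K) = {inside ?K, outside ?K}"
  proof -
    have "C = inside ?K \<or> C = outside ?K" if C: "C \<in> components (- ?K)" for C
    proof -
      obtain x where "x \<in> C" using C in_components_nonempty by blast
      moreover have "x \<in> - ?K" using C \<open>x \<in> C\<close> in_components_subset by blast
      ultimately consider "C \<inter> inside ?K \<noteq> {}" | "C \<inter> outside ?K \<noteq> {}" using J by blast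
      then show ?thesis using io C components_eq by metis
    qed
    then show ?thesis using io by blast
  qed
  then show ?thesis using that[of "inside ?K" "outside ?K"] J by blast
qed

text \<open>\<open>Y\<close> is the side of \<open>c1\<close> and \<open>c2\<close> that misses
  \<open>c\<close>. Together with the open arc of \<open>c2\<close> it is connected and misses
  \<open>c1\<close> and \<open>c\<close>, so it lies in one region \<open>S\<close> of these two
  arcs. The opposite region \<open>R\<close> then avoids \<open>Y\<close> and all three
  arcs.\<close>

lemma theta_other_region:
  fixes c1 c2 c :: "real \<Rightarrow> complex"
  assumes arcs: "arc c1" "arc c2" "arc c"
    and ends: "pathstart c1 = a" "pathfinish c1 = b" "pathstart c2 = a" "pathfinish c2 = b"
      "pathstart c = a" "pathfinish c = b"
    and int: "path_image c1 \<inter> path_image c2 = {a, b}" "path_image c1 \<inter> path_image c = {a, b}"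
      "path_image c2 \<inter> path_image c = {a, b}"
    and Y: "Y \<in> components (- (path_image c1 \<union> path_image c2))" "Y \<inter> path_image c = {}"
      "frontier Y = path_image c1 \<union> path_image c2"
  obtains R S where "components (- (path_image c1 \<union> path_image c)) = {R, S}"
    "Y \<subseteq> S" "frontier R = path_image c1 \<union> path_image c"
    "R \<inter> (path_image c1 \<union> path_image c2 \<union> path_image c \<union> Y) = {}"
proof -
  let ?K = "path_image c1 \<union> path_image c"
  obtain X1 X2 where X: "components (- ?K) = {X1, X2}" "X1 \<noteq> X2" "frontier X1 = ?K"
    "frontier X2 = ?K"
    by (rule Jordan_two_arcs[OF arcs(1,3) ends(1,2,5,6) int(2)])
  let ?Z = "Y \<union> (path_image c2 - {a, b})"
  \<comment> \<open>\<open>?Z\<close> lies between the connected set \<open>Y\<close> and its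
    closure, as \<open>c2\<close> is part of the frontier of \<open>Y\<close>.\<close>
  have "connected ?Z"
    using connected_intermediate_closure[of Y ?Z] in_components_connected[OF Y(1)] Y(3)
    by (auto simp: closure_Un_frontier)
  moreover have Zs: "?Z \<subseteq> - ?K"
    using Y(2) in_components_subset[OF Y(1)] int by auto
  moreover have "Y \<noteq> {}" using Y(1) in_components_nonempty by blast
  ultimately obtain S where S: "S \<in> components (- ?K)" "?Z \<subseteq> S"
    using exists_component_superset[of ?Z "- ?K"] by blast
  obtain R where R: "components (- ?K) = {R, S}" "R \<noteq> S" "frontier R = ?K"
  proof (cases "S = X1")
    case True
    then show ?thesis using that[of X2] X by (simp add: insert_commute)
  next
    case False
    then have "S = X2" using S(1) X(1) by simp
    then show ?thesis using that[of X1] X by simp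
  qed
  have "R \<inter> S = {}" using R components_nonoverlap[of R "- ?K" S] by simp
  moreover have "R \<subseteq> - ?K" using R in_components_subset by blast
  moreover have "{a, b} \<subseteq> ?K" using int by blast
  ultimately have "R \<inter> (path_image c1 \<union> path_image c2 \<union> path_image c \<union> Y) = {}"
    using S(2) by blast
  then show ?thesis using that R(1,3) S(2) by blast
qed

text \<open>The arc \<open>c\<close> cuts the region \<open>X\<close> in two. With \<open>Y\<close>
  the region on the other side of \<open>c1\<close> and \<open>c2\<close>, the parts are the region
  of \<open>c1\<close> and \<open>c\<close> away from \<open>Y\<close> and the region of
  \<open>c2\<close> and \<open>c\<close> away from \<open>Y\<close>.\<close>

lemma theta_regions:
  fixes c1 c2 c :: "real \<Rightarrow> complex"
  assumes arcs: "arc c1" "arc c2" "arc c"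
    and ends: "pathstart c1 = a" "pathfinish c1 = b" "pathstart c2 = a" "pathfinish c2 = b"
      "pathstart c = a" "pathfinish c = b"
    and int: "path_image c1 \<inter> path_image c2 = {a, b}" "path_image c1 \<inter> path_image c = {a, b}"
      "path_image c2 \<inter> path_image c = {a, b}"
    and X: "X \<in> components (- (path_image c1 \<union> path_image c2))" "path_image c - {a, b} \<subseteq> X"
  obtains R1 R2 where "R1 \<in> components (- (path_image c1 \<union> path_image c))"
    "R2 \<in> components (- (path_image c2 \<union> path_image c))" "R1 \<union> R2 = X - path_image c"
    "R1 \<inter> R2 = {}"
proof -
  let ?K = "path_image c1 \<union> path_image c2"
  obtain X1 X2 where X12: "components (- ?K) = {X1, X2}" "X1 \<noteq> X2" "frontier X1 = ?K"
    "frontier X2 = ?K"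
    by (rule Jordan_two_arcs[OF arcs(1,2) ends(1-4) int(1)])
  obtain Y where Y: "components (- ?K) = {X, Y}" "X \<noteq> Y" "frontier Y = ?K"
  proof (cases "X = X1")
    case True
    then show ?thesis using that[of X2] X12 by simp
  next
    case False
    then have "X = X2" using X(1) X12(1) by simp
    then show ?thesis using that[of X1] X12 by (simp add: insert_commute)
  qed
  then have XY: "X \<inter> Y = {}" "X \<union> Y = - ?K"
    using components_nonoverlap[of X "- ?K" Y] Union_components[of "- ?K"] by auto
  have Yc: "Y \<inter> path_image c = {}"
    using X(2) XY int by blast
  have Y1: "Y \<in> components (- ?K)" and Y1': "Y \<in> components (- (path_image c2 \<union> path_image c1))"
    using Y by (auto simp: Un_commute)
  have Y3': "frontier Y = path_image c2 \<union> path_image c1" using Y(3) by (simp add: Un_commute)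
  obtain R1 S1 where R1: "components (- (path_image c1 \<union> path_image c)) = {R1, S1}" "Y \<subseteq> S1"
    "frontier R1 = path_image c1 \<union> path_image c"
    "R1 \<inter> (path_image c1 \<union> path_image c2 \<union> path_image c \<union> Y) = {}"
    by (rule theta_other_region[OF arcs ends int Y1 Yc Y(3)])
  have int': "path_image c2 \<inter> path_image c1 = {a, b}" using int(1) by blast
  obtain R2 S2 where R2: "components (- (path_image c2 \<union> path_image c)) = {R2, S2}" "Y \<subseteq> S2"
    "frontier R2 = path_image c2 \<union> path_image c"
    "R2 \<inter> (path_image c2 \<union> path_image c1 \<union> path_image c \<union> Y) = {}"
    by (rule theta_other_region[OF arcs(2,1,3) ends(3,4,1,2,5,6) int' int(3,2) Y1' Yc Y3'])
  have "R1 \<union> R2 \<subseteq> X - path_image c"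
    using R1(4) R2(4) XY(2) by blast
  moreover
  \<comment> \<open>Otherwise \<open>z\<close> and \<open>Y\<close> are separated neither by \<open>c1 \<union> c\<close> nor by \<open>c2 \<union> c\<close>, and these sets
    meet in the connected set \<open>c\<close>.\<close>
  have "z \<in> R1 \<union> R2" if z: "z \<in> X - path_image c" for z
  proof (rule ccontr)
    assume "z \<notin> R1 \<union> R2"
    have "z \<notin> ?K" using z XY by blast
    have "R1 \<union> S1 = - (path_image c1 \<union> path_image c)" "R2 \<union> S2 = - (path_image c2 \<union> path_image c)"
      using Union_components[of "- (path_image c1 \<union> path_image c)"]
        Union_components[of "- (path_image c2 \<union> path_image c)"] unfolding R1(1) R2(1) by simp_all
    then have "z \<in> S1" "z \<in> S2"
      using \<open>z \<notin> ?K\<close> z \<open>z \<notin> R1 \<union> R2\<close> by blast+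
    have S: "S1 \<in> components (- (path_image c1 \<union> path_image c))"
      "S2 \<in> components (- (path_image c2 \<union> path_image c))"
      using R1(1) R2(1) by simp_all
    obtain y where y: "y \<in> Y" using in_components_nonempty[OF Y1] by blast
    have "connected_component (- (path_image c1 \<union> path_image c)) z y"
      unfolding connected_component_def
      using R1(2) \<open>z \<in> S1\<close> y in_components_connected[OF S(1)] in_components_subset[OF S(1)] by blast
    moreover have "connected_component (- (path_image c2 \<union> path_image c)) z y"
      unfolding connected_component_def
      using R2(2) \<open>z \<in> S2\<close> y in_components_connected[OF S(2)] in_components_subset[OF S(2)] by blast
    moreover have "(path_image c1 \<union> path_image c) \<inter> (path_image c2 \<union> path_image c) = path_image c"
      using int by blast
    moreover have "connected (path_image c)" "compact (path_image c1 \<union> path_image c)"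
      "closed (path_image c2 \<union> path_image c)"
      using arcs by (auto intro!: compact_Un closed_Un compact_arc_image closed_arc_image connected_arc_image)
    ultimately have "connected_component (- ((path_image c1 \<union> path_image c) \<union> (path_image c2 \<union>
      path_image c))) z y"
      by (rule_tac Janiszewski) (simp_all only:)
    then have "connected_component (- ?K) z y"
      by (rule connected_component_of_subset) blast
    then obtain T where "connected T" "T \<subseteq> - ?K" "z \<in> T" "y \<in> T"
      unfolding connected_component_def by blast
    then have "T \<subseteq> X" using components_maximal[OF X(1), of T] z by blast
    then show False using \<open>y \<in> T\<close> y XY by blast
  qed
  ultimately have "R1 \<union> R2 = X - path_image c" by blast
  moreover have "R1 \<inter> R2 = {}"
  proof (rule ccontr)
    \<comment> \<open>Both regions avoid all three arcs, so by maximality they coincide if they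
      meet. Equal frontiers then leave \<open>c1\<close> only its two ends, which is absurd for an
      arc.\<close>
    assume meet: "R1 \<inter> R2 \<noteq> {}"
    have comp: "R1 \<in> components (- (path_image c1 \<union> path_image c))"
      "R2 \<in> components (- (path_image c2 \<union> path_image c))"
      using R1(1) R2(1) by simp_all
    have "R2 \<subseteq> R1" "R1 \<subseteq> R2"
      using components_maximal[OF comp(1) in_components_connected[OF comp(2)]]
        components_maximal[OF comp(2) in_components_connected[OF comp(1)]] R1(4) R2(4) meet
        by blast+
    then have "R1 = R2" by blast
    then have "path_image c1 \<union> path_image c = path_image c2 \<union> path_image c"
      using R1(3) R2(3) by simp
    then have "path_image c1 \<subseteq> {a, b}"
      using int(1,2) by blast
    then show False
      using nonempty_simple_path_endless[OF arc_imp_simple_path[OF arcs(1)]] ends by auto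
  qed
  ultimately show ?thesis using that[of R1 R2] R1(1) R2(1) by simp
qed

section \<open>Paths, cycles and ears\<close>

fun path_edges :: "'a list \<Rightarrow> 'a set set" where
  "path_edges (x # y # xs) = insert {x, y} (path_edges (y # xs))"
| "path_edges _ = {}"

lemma path_edges_append: "path_edges (xs @ y # zs) = path_edges (xs @ [y]) \<union> path_edges (y # zs)"
proof (induction xs)
  case (Cons x xs)
  then show ?case by (cases xs) auto
qed simp

lemma path_edges_rev: "path_edges (rev xs) = path_edges xs"
proof (induction xs rule: path_edges.induct)
  case (1 x y xs)
  have "path_edges (rev (x # y # xs)) = path_edges (rev (y # xs)) \<union> {{y, x}}"
    using path_edges_append[of "rev xs" y "[x]"] by simp
  then show ?case using 1 by (auto simp: insert_commute)
qed simp_all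

lemma path_edges_conv_nth: "path_edges xs = {{xs ! i, xs ! Suc i} | i. Suc i < length xs}"
proof (induction xs rule: path_edges.induct)
  case (1 x y xs)
  have "{{(x # y # xs) ! i, (x # y # xs) ! Suc i} | i. Suc i < length (x # y # xs)} =
    insert {x, y} {{(y # xs) ! i, (y # xs) ! Suc i} | i. Suc i < length (y # xs)}"
    (is "?L = insert _ ?R")
  proof (intro equalityI subsetI)
    fix e assume "e \<in> ?L"
    then obtain i where i: "e = {(x # y # xs) ! i, (x # y # xs) ! Suc i}"
      "Suc i < length (x # y # xs)" by blast
    then show "e \<in> insert {x, y} ?R" by (cases i) auto
  next
    fix e assume "e \<in> insert {x, y} ?R"
    then consider "e = {x, y}" | i where "e = {(y # xs) ! i, (y # xs) ! Suc i}"
      "Suc i < length (y # xs)"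
      by blast
    then show "e \<in> ?L"
    proof cases
      case 1
      then have "e = {(x # y # xs) ! 0, (x # y # xs) ! Suc 0}"
        "Suc 0 < length (x # y # xs)" by simp_all
      then show ?thesis by blast
    next
      case (2 i)
      then have "e = {(x # y # xs) ! Suc i, (x # y # xs) ! Suc (Suc i)}"
        "Suc (Suc i) < length (x # y # xs)" by simp_all
      then show ?thesis by blast
    qed
  qed
  then show ?case using 1 by simp
qed simp_all

lemma Union_path_edges_subset: "\<Union> (path_edges xs) \<subseteq> set xs"
  by (induction xs rule: path_edges.induct) auto

lemma Union_path_edges: "length xs \<ge> 2 \<Longrightarrow> \<Union> (path_edges xs) = set xs"
proof (induction xs rule: path_edges.induct)
  case (1 x y xs)
  then show ?case by (cases xs) auto
qed simp_all

lemma finite_path_edges [simp]: "finite (path_edges xs)"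
  by (induction xs rule: path_edges.induct) auto

lemma card_path_edges: "distinct xs \<Longrightarrow> card (path_edges xs) = length xs - 1"
proof (induction xs rule: path_edges.induct)
  case (1 x y xs)
  have "{x, y} \<notin> path_edges (y # xs)"
    using Union_path_edges_subset[of "y # xs"] 1(2) by auto
  then show ?case using 1 by simp
qed simp_all

text \<open>Used to see that the two paths into which a cycle is split share no edge.\<close>

lemma chord_notin_path_edges:
  assumes "distinct (a # ys @ [b])" "{a, b} \<in> path_edges (a # ys @ [b])"
  shows "ys = []"
proof (cases ys)
  case (Cons y ys')
  have "{a, b} \<notin> path_edges (y # ys' @ [b])"
    using Union_path_edges_subset[of "y # ys' @ [b]"] assms(1) Cons by auto
  then show ?thesis using assms Cons by (auto simp: doubleton_eq_iff)
qed

definition cycle_edges :: "'a list \<Rightarrow> 'a set set" where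
  "cycle_edges c = path_edges (c @ [hd c])"

text \<open>Reversing \<open>zs\<close> makes both paths run from \<open>a\<close> to
  \<open>b\<close>, as the arcs of a theta curve do.\<close>

lemma cycle_edges_two_paths:
  "cycle_edges (a # ys @ b # rev zs) = path_edges (a # ys @ [b]) \<union> path_edges (a # zs @ [b])"
proof -
  have "path_edges ((a # ys) @ b # rev zs @ [a]) = path_edges (a # ys @ [b]) \<union>
    path_edges (b # rev zs @ [a])"
    by (subst path_edges_append) simp
  moreover have "path_edges (b # rev zs @ [a]) = path_edges (a # zs @ [b])"
    using path_edges_rev[of "a # zs @ [b]"] by simp
  ultimately show ?thesis by (simp add: cycle_edges_def)
qed

text \<open>The cycle is rotated so that it starts at \<open>a\<close>, which keeps its edges, and
  is then cut at \<open>b\<close>.\<close>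

lemma cycle_split:
  assumes "distinct c" "a \<in> set c" "b \<in> set c" "a \<noteq> b"
  obtains ys zs where "distinct (a # ys @ b # rev zs)" "length c = length ys + length zs + 2"
    "set c = set (a # ys @ b # rev zs)"
    "cycle_edges c = path_edges (a # ys @ [b]) \<union> path_edges (a # zs @ [b])"
proof -
  obtain us vs where c: "c = us @ a # vs" using assms(2) by (meson split_list)
  have "b \<in> set (vs @ us)" using assms c by auto
  then obtain ys ws where w: "vs @ us = ys @ b # ws" by (meson split_list)
  have "cycle_edges c = cycle_edges (a # vs @ us)"
  proof (cases us)
    case (Cons u us')
    have "cycle_edges c = path_edges (us @ [a]) \<union> path_edges ((a # vs) @ u # [])"
      using path_edges_append[of us a "vs @ [u]"] Cons by (simp add: cycle_edges_def c)
    moreover have "cycle_edges (a # vs @ us) = path_edges ((a # vs) @ u # []) \<union>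
      path_edges (us @ [a])"
      using path_edges_append[of "a # vs" u "us' @ [a]"] Cons by (simp add: cycle_edges_def)
    ultimately show ?thesis by blast
  qed (simp add: c)
  also have "\<dots> = cycle_edges (a # ys @ b # rev (rev ws))"
    using w by simp
  finally have "cycle_edges c = path_edges (a # ys @ [b]) \<union> path_edges (a # rev ws @ [b])"
    by (simp only: cycle_edges_two_paths)
  moreover have "length vs + length us = length ys + length ws + 1"
    using arg_cong[OF w, of length] by simp
  moreover have "distinct (a # vs @ us)" using assms(1) c by auto
  moreover have "set c = set (a # vs @ us)" using c by auto
  ultimately show ?thesis
    using that[of ys "rev ws"] w by (simp add: c)
qed

lemma is_cycle_if_cycle_edges:
  assumes "distinct c" "length c \<ge> 3" "cycle_edges c \<subseteq> E"
  shows "is_cycle E c"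
  unfolding is_cycle_def
proof (intro conjI allI impI)
  fix i assume i: "i < length c"
  have "c \<noteq> []" using assms(2) by auto
  have "c ! (Suc i mod length c) = (c @ [hd c]) ! Suc i"
  proof (cases "Suc i = length c")
    case True
    then show ?thesis by (simp only: mod_self nth_append_length hd_conv_nth[OF \<open>c \<noteq> []\<close>])
  next
    case False
    then show ?thesis using i by (simp add: nth_append)
  qed
  then have "{c ! i, c ! (Suc i mod length c)} = {(c @ [hd c]) ! i, (c @ [hd c]) ! Suc i}"
    using i by (simp add: nth_append)
  then have "{c ! i, c ! (Suc i mod length c)} \<in> cycle_edges c"
    unfolding cycle_edges_def path_edges_conv_nth using i by auto
  then show "{c ! i, c ! (Suc i mod length c)} \<in> E" using assms(3) by blast
qed (use assms in auto)

text \<open>\<open>A\<close> and \<open>B\<close> are the sides of a separation. For finite graphs,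
  order 0 excludes disconnected graphs and order 1 excludes cutvertices; a single vertex and a
  single edge qualify.\<close>

definition nonseparable :: "'a set \<Rightarrow> 'a set set \<Rightarrow> bool" where
  "nonseparable V E \<longleftrightarrow>
    (\<forall>A B. A \<union> B = V \<and> E \<subseteq> Pow A \<union> Pow B \<and> card (A \<inter> B) \<le> 1 \<longrightarrow> A = V \<or> B = V)"

text \<open>A walk is followed step by step; when it returns to a vertex of the path built so far,
  the path is cut back to that vertex.\<close>

lemma rtrancl_imp_distinct_path:
  assumes "(x, y) \<in> {(u, v). {u, v} \<in> E \<and> u \<in> S \<and> v \<in> S}\<^sup>*" "x \<in> S"
  shows "\<exists>xs. distinct xs \<and> xs \<noteq> [] \<and> hd xs = x \<and> last xs = y \<and> path_edges xs \<subseteq> E \<and> set xs \<subseteq> S"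
  using assms(1)
proof (induction rule: rtrancl_induct)
  case base
  show ?case by (rule exI[of _ "[x]"]) (use assms in auto)
next
  case (step y z)
  then obtain xs where xs: "distinct xs" "xs \<noteq> []" "hd xs = x" "last xs = y" "path_edges xs \<subseteq> E"
    "set xs \<subseteq> S"
    by blast
  show ?case
  proof (cases "z \<in> set xs")
    case True
    then obtain us vs where uv: "xs = us @ z # vs" by (meson split_list)
    have "path_edges (us @ [z]) \<subseteq> E" using xs(5) unfolding uv path_edges_append[of us z vs] by blast
    moreover have "hd (us @ [z]) = x" using xs(3) uv by (cases us) auto
    ultimately show ?thesis
      by (intro exI[of _ "us @ [z]"]) (use xs uv in auto)
  next
    case False
    obtain ws where ws: "xs = ws @ [y]" using xs(2,4) by (metis append_butlast_last_id)
    have "path_edges (xs @ [z]) \<subseteq> E"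
      using path_edges_append[of ws y "[z]"] xs(5) step(2) ws by auto
    then show ?thesis
      by (intro exI[of _ "xs @ [z]"]) (use xs step False in auto)
  qed
qed

text \<open>An edge outside \<open>F\<close> with both ends on \<open>F\<close> is itself an ear.
  Otherwise it has an end \<open>y\<close> off \<open>F\<close>. The component \<open>K\<close> of
  \<open>y\<close> off \<open>F\<close> has at least two neighbours on \<open>F\<close>, and a path
  through \<open>K\<close> joins two of them.\<close>

lemma ear_exists:
  assumes G: "simple_graph V E" and ns: "nonseparable V E" and F: "F \<subseteq> E" "F \<noteq> {}" "F \<noteq> E"
  obtains a ws b where "distinct (a # ws @ [b])" "a \<in> \<Union>F" "b \<in> \<Union>F" "set ws \<inter> \<Union>F = {}"
    "path_edges (a # ws @ [b]) \<subseteq> E - F"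
proof -
  have E: "e \<subseteq> V" "card e = 2" if "e \<in> E" for e
    using G that by (auto simp: simple_graph_def)
  obtain e where e: "e \<in> E" "e \<notin> F" using F by blast
  show ?thesis
  proof (cases "e \<subseteq> \<Union>F")
    case True
    obtain x y where "e = {x, y}" "x \<noteq> y" using E(2)[OF e(1)] by (auto simp: card_2_iff)
    then show ?thesis using that[of x "[]" y] True e by auto
  next
    case False
    then obtain y where y: "y \<in> e" "y \<notin> \<Union>F" by blast
    let ?S = "- \<Union>F"
    let ?r = "{(u, v). {u, v} \<in> E \<and> u \<in> ?S \<and> v \<in> ?S}"
    define K where "K = {z. (y, z) \<in> ?r\<^sup>*}"
    define N where "N = {a \<in> \<Union>F. \<exists>z\<in>K. {a, z} \<in> E}"
    have "y \<in> K" by (simp add: K_def)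
    have KS: "K \<subseteq> ?S"
    proof
      fix z assume "z \<in> K"
      then have "(y, z) \<in> ?r\<^sup>*" by (simp add: K_def)
      then show "z \<in> ?S" by (cases rule: rtranclE) (use y in auto)
    qed
    have KV: "K \<subseteq> V"
    proof
      fix z assume "z \<in> K"
      then have "(y, z) \<in> ?r\<^sup>*" by (simp add: K_def)
      then show "z \<in> V" by (cases rule: rtranclE) (use y e E in auto)
    qed
    have FV: "\<Union>F \<subseteq> V" using F(1) E by blast
    have finN: "finite N"
      using G FV finite_subset unfolding N_def simple_graph_def
      by (metis (no_types, lifting) mem_Collect_eq subsetI)
    \<comment> \<open>Otherwise \<open>V - K\<close> and \<open>K \<union> N\<close> form a
      separation of order at most 1. Neither side is all of \<open>V\<close>: the first misses
      \<open>y\<close>, and the second could be only if \<open>N\<close> contained both ends of an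
      edge of \<open>F\<close>.\<close>
    have "\<not> card N \<le> 1"
    proof
      assume N: "card N \<le> 1"
      have "f \<subseteq> V - K \<or> f \<subseteq> K \<union> N" if f: "f \<in> E" for f
      proof (rule disjCI)
        assume "\<not> f \<subseteq> K \<union> N"
        then obtain u where u: "u \<in> f" "u \<notin> K" "u \<notin> N" by blast
        obtain v where v: "f = {u, v}"
          using E(2)[OF f] u(1) by (metis card_2_iff insertE insert_commute singletonD)
        have "v \<notin> K"
        proof
          assume "v \<in> K"
          show False
          proof (cases "u \<in> \<Union>F")
            case True
            then show False using u(3) \<open>v \<in> K\<close> f v by (auto simp: N_def)
          next
            case False
            then have "(v, u) \<in> ?r" using \<open>v \<in> K\<close> KS f v by (auto simp: insert_commute)
            moreover have "(y, v) \<in> ?r\<^sup>*" using \<open>v \<in> K\<close> by (simp add: K_def)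
            ultimately have "(y, u) \<in> ?r\<^sup>*" by (rule rtrancl_into_rtrancl[rotated])
            then show False using u(2) by (simp add: K_def)
          qed
        qed
        then show "f \<subseteq> V - K" using u v E(1)[OF f] by blast
      qed
      moreover have "(V - K) \<union> (K \<union> N) = V" using KV FV by (auto simp: N_def)
      moreover have "card ((V - K) \<inter> (K \<union> N)) \<le> 1"
        using N card_mono[OF finN, of "(V - K) \<inter> (K \<union> N)"] by fastforce
      ultimately have "V - K = V \<or> K \<union> N = V"
        using ns[unfolded nonseparable_def, rule_format, of "V - K" "K \<union> N"] by blast
      then have "K \<union> N = V" using \<open>y \<in> K\<close> KV by blast
      then have "\<Union>F \<subseteq> N" using KS FV by blast
      moreover obtain f where "f \<in> F" using F(2) by blast
      ultimately have "card f \<le> card N" using finN by (intro card_mono) auto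
      then show False using N E(2) \<open>f \<in> F\<close> F(1) by fastforce
    qed
    then obtain a b where ab: "a \<in> N" "b \<in> N" "a \<noteq> b"
      using card_le_Suc0_iff_eq[OF finN] by auto
    then obtain z z' where z: "z \<in> K" "{a, z} \<in> E" "z' \<in> K" "{b, z'} \<in> E" by (auto simp: N_def)
    have "sym ?r" by (auto simp: sym_def insert_commute)
    then have "sym (?r\<^sup>*)" by (rule sym_rtrancl)
    moreover have yz: "(y, z) \<in> ?r\<^sup>*" "(y, z') \<in> ?r\<^sup>*" using z by (simp_all add: K_def)
    ultimately have "(z, y) \<in> ?r\<^sup>*" by (blast dest: symD)
    then have "(z, z') \<in> ?r\<^sup>*" using yz(2) by (rule rtrancl_trans)
    then obtain xs where xs: "distinct xs" "xs \<noteq> []" "hd xs = z" "last xs = z'" "path_edges xs \<subseteq> E"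
      "set xs \<subseteq> ?S"
      using rtrancl_imp_distinct_path[of z z' E ?S] z KS by blast
    obtain us where us: "xs = us @ [z']" using xs(2,4) by (metis append_butlast_last_id)
    obtain vs where vs: "xs = z # vs" using xs(2,3) by (metis list.collapse)
    have "path_edges (a # xs @ [b]) = insert {a, z} (path_edges (xs @ [b]))" using vs by simp
    also have "path_edges (xs @ [b]) = path_edges xs \<union> {{z', b}}"
      using path_edges_append[of us z' "[b]"] us by simp
    finally have pe: "path_edges (a # xs @ [b]) = insert {a, z} (path_edges xs \<union> {{z', b}})" .
    have "path_edges (a # xs @ [b]) \<subseteq> E"
      unfolding pe using z xs(5) by (auto simp: insert_commute)
    moreover have "f \<notin> F" if f: "f \<in> path_edges (a # xs @ [b])" for f
    proof -
      have "f \<inter> ?S \<noteq> {}"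
      proof -
        have "f \<noteq> {}" using f \<open>path_edges (a # xs @ [b]) \<subseteq> E\<close> E(2) by fastforce
        then show ?thesis using f z KS Union_path_edges_subset[of xs] xs(6) unfolding pe by blast
      qed
      then show ?thesis by blast
    qed
    moreover have "a \<notin> set xs" "b \<notin> set xs" using ab xs(6) by (auto simp: N_def)
    ultimately show ?thesis
    proof (intro that[of a xs b])
      show "path_edges (a # xs @ [b]) \<subseteq> E - F"
        using \<open>path_edges (a # xs @ [b]) \<subseteq> E\<close> \<open>\<And>f. f \<in> path_edges (a # xs @ [b]) \<Longrightarrow> f \<notin> F\<close> by blast
    qed (use xs ab in \<open>auto simp: N_def\<close>)
  qed
qed

section \<open>Faces of plane graphs\<close>

definition edge_image :: "('a set \<Rightarrow> real \<Rightarrow> complex) \<Rightarrow> 'a set set \<Rightarrow> complex set" where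
  "edge_image \<gamma> F = (\<Union>e\<in>F. path_image (\<gamma> e))"

lemma edge_image_Un: "edge_image \<gamma> (F \<union> F') = edge_image \<gamma> F \<union> edge_image \<gamma> F'"
  by (auto simp: edge_image_def)

lemma edge_image_mono: "F \<subseteq> F' \<Longrightarrow> edge_image \<gamma> F \<subseteq> edge_image \<gamma> F'"
  by (auto simp: edge_image_def)

text \<open>Each face of a plane 2-connected graph is recorded as a pair of its boundary cycle and its
  region. The two equations are Euler's formula and the count of edge sides.\<close>

definition face_system :: "('a set \<Rightarrow> real \<Rightarrow> complex) \<Rightarrow> 'a set set \<Rightarrow> ('a list \<times> complex set) list
  \<Rightarrow> bool" where
  "face_system \<gamma> F L \<longleftrightarrow>
     length L + card (\<Union>F) = card F + 2 \<and>
     sum_list (map (length \<circ> fst) L) = 2 * card F \<and>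
     (\<forall>(c, R)\<in>set L. distinct c \<and> length c \<ge> 3 \<and> cycle_edges c \<subseteq> F \<and>
        R \<in> components (- edge_image \<gamma> (cycle_edges c)) \<and> R \<inter> edge_image \<gamma> F = {}) \<and>
     sorted_wrt (\<lambda>x y. snd x \<inter> snd y = {}) L \<and>
     - edge_image \<gamma> F \<subseteq> \<Union> (snd ` set L)"

section \<open>Arcs drawn along paths, and faces built ear by ear\<close>

locale drawn_graph =
  fixes V :: "'a set" and E :: "'a set set" and p :: "'a \<Rightarrow> complex"
    and \<gamma> :: "'a set \<Rightarrow> real \<Rightarrow> complex"
  assumes simple: "simple_graph V E" and drawing: "plane_drawing V E p \<gamma>"
begin

lemma edge: "e \<in> E \<Longrightarrow> e \<subseteq> V" "e \<in> E \<Longrightarrow> card e = 2"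
  using simple by (auto simp: simple_graph_def)

lemma finite_edges: "finite E"
proof (rule finite_subset)
  show "E \<subseteq> Pow V" using edge(1) by blast
qed (use simple in \<open>simp add: simple_graph_def\<close>)

lemma inj: "inj_on p V"
  using drawing by (simp add: plane_drawing_def)

lemma arc_edge:
  assumes "e \<in> E"
  shows "arc (\<gamma> e)" "{pathstart (\<gamma> e), pathfinish (\<gamma> e)} = p ` e" "path_image (\<gamma> e) \<inter> p ` V = p ` e"
  using drawing assms by (auto simp: plane_drawing_def)

text \<open>The drawing makes a common point of two edges some vertex. As an edge meets vertices
  only at its own ends and \<open>p\<close> is injective, it is a common end.\<close>

lemma edge_image_Int:
  assumes "F \<subseteq> E" "F' \<subseteq> E" "F \<inter> F' = {}"
  shows "edge_image \<gamma> F \<inter> edge_image \<gamma> F' \<subseteq> p ` (\<Union>F \<inter> \<Union>F')"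
proof
  fix z assume "z \<in> edge_image \<gamma> F \<inter> edge_image \<gamma> F'"
  then obtain e f where ef: "e \<in> F" "f \<in> F'" "z \<in> path_image (\<gamma> e)" "z \<in> path_image (\<gamma> f)"
    by (auto simp: edge_image_def)
  then have "e \<in> E" "f \<in> E" "e \<noteq> f" using assms by auto
  then have "z \<in> p ` V" using drawing ef unfolding plane_drawing_def by blast
  then have "z \<in> p ` e" "z \<in> p ` f"
    using ef arc_edge(3)[OF \<open>e \<in> E\<close>] arc_edge(3)[OF \<open>f \<in> E\<close>] by auto
  then obtain x y where xy: "x \<in> e" "y \<in> f" "z = p x" "z = p y" by blast
  then have "x = y" using inj edge(1)[OF \<open>e \<in> E\<close>] edge(1)[OF \<open>f \<in> E\<close>] by (auto dest: inj_onD)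
  then show "z \<in> p ` (\<Union>F \<inter> \<Union>F')" using xy ef by blast
qed

lemma vertex_in_edge_image:
  assumes "F \<subseteq> E" "x \<in> V"
  shows "p x \<in> edge_image \<gamma> F \<longleftrightarrow> x \<in> \<Union>F"
proof
  assume "p x \<in> edge_image \<gamma> F"
  then obtain e where e: "e \<in> F" "p x \<in> path_image (\<gamma> e)" by (auto simp: edge_image_def)
  then have "p x \<in> p ` e" using arc_edge(3)[of e] assms by blast
  then have "x \<in> e" using inj edge(1)[of e] e assms by (auto dest: inj_onD)
  then show "x \<in> \<Union>F" using e by blast
next
  assume "x \<in> \<Union>F"
  then obtain e where e: "x \<in> e" "e \<in> F" by blast
  then have "p x \<in> path_image (\<gamma> e)" using arc_edge(3)[of e] assms by blast
  then show "p x \<in> edge_image \<gamma> F" using e by (auto simp: edge_image_def)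
qed

text \<open>The drawing does not say at which end \<open>\<gamma> {x, y}\<close> starts, so the arc
  may have to be reversed.\<close>

lemma edge_arc:
  assumes "{x, y} \<in> E"
  obtains g where "arc g" "pathstart g = p x" "pathfinish g = p y"
    "path_image g = path_image (\<gamma> {x, y})"
proof (cases "pathstart (\<gamma> {x, y}) = p x")
  case True
  have "p x \<noteq> p y"
    using edge[OF assms] inj by (auto simp: card_2_iff doubleton_eq_iff dest: inj_onD)
  then have "pathfinish (\<gamma> {x, y}) = p y"
    using arc_edge(2)[OF assms] True by (auto simp: doubleton_eq_iff)
  then show ?thesis using that[of "\<gamma> {x, y}"] arc_edge(1)[OF assms] True by blast
next
  case False
  then have "pathstart (\<gamma> {x, y}) = p y" "pathfinish (\<gamma> {x, y}) = p x"
    using arc_edge(2)[OF assms] by (auto simp: doubleton_eq_iff)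
  then show ?thesis
    using that[of "reversepath (\<gamma> {x, y})"] arc_edge(1)[OF assms] by (simp add: arc_reversepath)
qed

lemma path_arc:
  assumes "distinct xs" "length xs \<ge> 2" "path_edges xs \<subseteq> E"
  shows "\<exists>g. arc g \<and> pathstart g = p (hd xs) \<and> pathfinish g = p (last xs) \<and>
    path_image g = edge_image \<gamma> (path_edges xs)"
  using assms
proof (induction xs rule: path_edges.induct)
  case (1 x y xs)
  have xy: "{x, y} \<in> E" using 1 by simp
  obtain g where g: "arc g" "pathstart g = p x" "pathfinish g = p y"
    "path_image g = path_image (\<gamma> {x, y})"
    by (rule edge_arc[OF xy])
  show ?case
  proof (cases "xs = []")
    case True
    then show ?thesis using g by (intro exI[of _ g]) (auto simp: edge_image_def)
  next
    case False
    then have "length (y # xs) \<ge> 2" by (cases xs) auto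
    then obtain h where h: "arc h" "pathstart h = p y" "pathfinish h = p (last (y # xs))"
      "path_image h = edge_image \<gamma> (path_edges (y # xs))"
      using 1 by auto
    have nx: "x \<notin> \<Union> (path_edges (y # xs))"
      using Union_path_edges_subset[of "y # xs"] 1(2) by auto
    have "edge_image \<gamma> {{x, y}} \<inter> edge_image \<gamma> (path_edges (y # xs)) \<subseteq> p ` (\<Union>{{x, y}} \<inter>
      \<Union> (path_edges (y # xs)))"
      by (rule edge_image_Int) (use 1 nx in auto)
    then have "path_image g \<inter> path_image h \<subseteq> {p y}"
      using nx g h by (auto simp: edge_image_def)
    then have "arc (g +++ h)" using g h by (intro arc_join) auto
    moreover have "path_image (g +++ h) = edge_image \<gamma> (path_edges (x # y # xs))"
      using g h by (subst path_image_join) (auto simp: edge_image_def)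
    ultimately show ?thesis
      using g h False by (intro exI[of _ "g +++ h"]) auto
  qed
qed simp_all

lemma internal_path_arc:
  assumes "distinct (a # ws @ [b])" "path_edges (a # ws @ [b]) \<subseteq> E"
  obtains g where "arc g" "pathstart g = p a" "pathfinish g = p b"
    "path_image g = edge_image \<gamma> (path_edges (a # ws @ [b]))"
proof -
  have "length (a # ws @ [b]) \<ge> 2" by simp
  from path_arc[OF assms(1) this assms(2)] show ?thesis using that by auto
qed

lemma disjoint_paths_Int:
  assumes "path_edges (a # ws @ [b]) \<subseteq> E" "path_edges (a # zs @ [b]) \<subseteq> E"
    "path_edges (a # ws @ [b]) \<inter> path_edges (a # zs @ [b]) = {}" "set ws \<inter> set zs = {}"
    "a \<notin> set ws \<union> set zs" "b \<notin> set ws \<union> set zs"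
  shows "edge_image \<gamma> (path_edges (a # ws @ [b])) \<inter>
    edge_image \<gamma> (path_edges (a # zs @ [b])) = {p a, p b}"
proof -
  have U: "\<Union> (path_edges (a # us @ [b])) = insert a (insert b (set us))" for us
    using Union_path_edges[of "a # us @ [b]"] by auto
  have "a \<in> V" "b \<in> V" using assms(1) U[of ws] edge(1) by blast+
  then have "p a \<in> edge_image \<gamma> (path_edges (a # us @ [b]))"
    "p b \<in> edge_image \<gamma> (path_edges (a # us @ [b]))"
    if "path_edges (a # us @ [b]) \<subseteq> E" for us
    using vertex_in_edge_image[OF that] U[of us] by blast+
  then have "{p a, p b} \<subseteq> edge_image \<gamma> (path_edges (a # ws @ [b])) \<inter>
    edge_image \<gamma> (path_edges (a # zs @ [b]))"
    using assms(1,2) by simp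
  moreover have "\<Union> (path_edges (a # ws @ [b])) \<inter> \<Union> (path_edges (a # zs @ [b])) = {a, b}"
    unfolding U using assms by auto
  then have "edge_image \<gamma> (path_edges (a # ws @ [b])) \<inter>
    edge_image \<gamma> (path_edges (a # zs @ [b])) \<subseteq> {p a, p b}"
    using edge_image_Int[OF assms(1-3)] by simp
  ultimately show ?thesis by (rule equalityI[rotated])
qed

text \<open>The start of the ear decomposition. Both Jordan regions are recorded with the same
  boundary cycle, so every edge has its two sides counted.\<close>

lemma face_system_cycle:
  assumes "{a, b} \<in> E" "distinct (a # ws @ [b])" "path_edges (a # ws @ [b]) \<subseteq> E - {{a, b}}"
  shows "\<exists>L. face_system \<gamma> (path_edges (a # ws @ [b]) \<union> {{a, b}}) L"
proof -
  let ?P = "path_edges (a # ws @ [b])" and ?c = "a # ws @ [b]"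
  have ab: "path_edges (a # [] @ [b]) = {{a, b}}" by simp
  obtain g where g: "arc g" "pathstart g = p a" "pathfinish g = p b"
    "path_image g = edge_image \<gamma> ?P"
    by (rule internal_path_arc[of a ws b]) (use assms in auto)
  obtain h where h: "arc h" "pathstart h = p a" "pathfinish h = p b"
    "path_image h = edge_image \<gamma> {{a, b}}"
    by (rule internal_path_arc[of a "[]" b]) (use assms in auto)
  have "path_image g \<inter> path_image h = {p a, p b}"
    using disjoint_paths_Int[of a ws b "[]"] assms unfolding g h ab by auto
  then obtain X Y where XY: "components (- (path_image g \<union> path_image h)) = {X, Y}" "X \<noteq> Y"
    using Jordan_two_arcs[OF g(1) h(1) g(2,3) h(2,3)] by metis
  have ce: "cycle_edges ?c = ?P \<union> {{a, b}}"
    using cycle_edges_two_paths[of a ws b "[]"] by simp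
  have im: "path_image g \<union> path_image h = edge_image \<gamma> (?P \<union> {{a, b}})"
    unfolding g h edge_image_Un by simp
  have "ws \<noteq> []" using assms(3) by auto
  then have len: "length ?c \<ge> 3" by (cases ws) auto
  have "\<Union> (?P \<union> {{a, b}}) = set ?c" using Union_path_edges[of ?c] by auto
  then have cU: "card (\<Union> (?P \<union> {{a, b}})) = length ?c" using distinct_card[OF assms(2)] by simp
  have "{a, b} \<notin> ?P" using assms(3) by blast
  then have cE: "card (?P \<union> {{a, b}}) = length ?c"
    using card_path_edges[OF assms(2)] by simp
  have XYc: "X \<in> components (- edge_image \<gamma> (?P \<union> {{a, b}}))"
    "Y \<in> components (- edge_image \<gamma> (?P \<union> {{a, b}}))"
    using XY(1) im by auto
  then have "X \<inter> Y = {}" using XY(2) components_nonoverlap by blast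
  moreover have "X \<union> Y = - edge_image \<gamma> (?P \<union> {{a, b}})"
    using Union_components[of "- (path_image g \<union> path_image h)"] unfolding XY(1) unfolding im
    by (simp only: Union_insert Union_empty Un_empty_right)
  ultimately have "face_system \<gamma> (?P \<union> {{a, b}}) [(?c, X), (?c, Y)]"
    unfolding face_system_def cU cE using assms(2) len XYc ce by auto
  then show ?thesis by blast
qed

text \<open>The open ear lies in one recorded region \<open>R\<close> and splits it as in a theta
  curve, with the two paths of the cycle \<open>c\<close> between \<open>a\<close> and
  \<open>b\<close> as outer arcs. An ear with \<open>k\<close> inner vertices adds \<open>k\<close>
  vertices, \<open>k + 1\<close> edges and one face, and its edges are counted once in each new
  boundary, so both equations persist.\<close>

lemma face_system_ear:
  assumes F: "F \<subseteq> E" and L: "face_system \<gamma> F L"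
    and ear: "distinct (a # ws @ [b])" "a \<in> \<Union>F" "b \<in> \<Union>F" "set ws \<inter> \<Union>F = {}"
      "path_edges (a # ws @ [b]) \<subseteq> E - F"
  shows "\<exists>L'. face_system \<gamma> (F \<union> path_edges (a # ws @ [b])) L'"
proof -
  let ?P = "path_edges (a # ws @ [b])"
  have PE: "?P \<subseteq> E" using ear by blast
  have finF: "finite F" using F finite_edges finite_subset by blast
  obtain g where g: "arc g" "pathstart g = p a" "pathfinish g = p b"
    "path_image g = edge_image \<gamma> ?P"
    by (rule internal_path_arc[OF ear(1) PE])
  have abV: "a \<in> V" "b \<in> V" using ear F edge(1) by blast+
  have UP: "\<Union>?P = insert a (insert b (set ws))"
    using Union_path_edges[of "a # ws @ [b]"] by auto
  have gF: "path_image g \<inter> edge_image \<gamma> F \<subseteq> {p a, p b}"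
  proof -
    have "?P \<inter> F = {}" using ear by blast
    from edge_image_Int[OF PE F this] show ?thesis unfolding g UP using ear by blast
  qed
  let ?I = "path_image g - {p a, p b}"
  have "connected ?I" "?I \<noteq> {}"
    using connected_simple_path_endless[of g]
    nonempty_simple_path_endless[of g] arc_imp_simple_path g by auto
  then obtain z where z: "z \<in> ?I" by blast
  then have "z \<in> - edge_image \<gamma> F" using gF by blast
  then have "z \<in> \<Union> (snd ` set L)"
    using L unfolding face_system_def by blast
  then obtain c R where cR: "(c, R) \<in> set L" "z \<in> R" by auto
  then have c: "distinct c" "length c \<ge> 3" "cycle_edges c \<subseteq> F"
    and R: "R \<in> components (- edge_image \<gamma> (cycle_edges c))" "R \<inter> edge_image \<gamma> F = {}"
    using L unfolding face_system_def by auto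
  have cF: "edge_image \<gamma> (cycle_edges c) \<subseteq> edge_image \<gamma> F" using c(3) by (rule edge_image_mono)
  have cE: "cycle_edges c \<subseteq> E" using c(3) F by blast
  have IR: "?I \<subseteq> R"
    using components_maximal[OF R(1) \<open>connected ?I\<close>] gF cF z cR(2) by blast
  have cl: "path_image g \<subseteq> closure R"
  proof -
    have I: "?I = g ` {0<..<1}"
      using simple_path_endless[OF arc_imp_simple_path[OF g(1)]] g by simp
    have "g ` closure {0<..<1} \<subseteq> closure ?I"
      by (rule image_closure_subset)
        (use g(1) closure_subset[of ?I] in \<open>auto simp: I[symmetric] arc_def path_def\<close>)
    then have "path_image g \<subseteq> closure ?I" by (simp add: path_image_def)
    then show ?thesis using closure_mono[OF IR] by blast
  qed
  have fr: "closure R - R \<subseteq> edge_image \<gamma> (cycle_edges c)"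
  proof -
    have "closed (edge_image \<gamma> (cycle_edges c))"
      unfolding edge_image_def
      by (intro closed_UN ballI closed_arc_image arc_edge(1)) (use cE in \<open>auto simp: cycle_edges_def\<close>)
    then have "frontier R \<subseteq> edge_image \<gamma> (cycle_edges c)"
      using R(1) frontier_of_components_closed_complement by blast
    then show ?thesis using interior_subset[of R] by (auto simp: frontier_def)
  qed
  \<comment> \<open>The ends of the ear lie in the closure of \<open>R\<close>, but also on
    \<open>F\<close>, which \<open>R\<close> avoids. So they lie on the frontier of \<open>R\<close>
    and hence on \<open>c\<close>.\<close>
  have "p a \<in> path_image g" "p b \<in> path_image g"
    using g pathstart_in_path_image pathfinish_in_path_image by metis+
  moreover have "p a \<in> edge_image \<gamma> F" "p b \<in> edge_image \<gamma> F"
    using vertex_in_edge_image[OF F] abV ear by blast+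
  moreover note vF = this
  ultimately have "p a \<in> edge_image \<gamma> (cycle_edges c)" "p b \<in> edge_image \<gamma> (cycle_edges c)"
    using cl fr R(2) by blast+
  then have "a \<in> \<Union> (cycle_edges c)" "b \<in> \<Union> (cycle_edges c)"
    using vertex_in_edge_image[OF cE] abV by blast+
  moreover have "\<Union> (cycle_edges c) \<subseteq> set c"
    using Union_path_edges_subset[of "c @ [hd c]"] c(2) by (cases c) (auto simp: cycle_edges_def)
  ultimately have "a \<in> set c" "b \<in> set c" by blast+
  moreover have "a \<noteq> b" using ear(1) by auto
  ultimately obtain ys zs where yz: "distinct (a # ys @ b # rev zs)"
    "length c = length ys + length zs + 2"
      "set c = set (a # ys @ b # rev zs)"
      "cycle_edges c = path_edges (a # ys @ [b]) \<union> path_edges (a # zs @ [b])"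
    using cycle_split[OF c(1)] by metis
  let ?A = "path_edges (a # ys @ [b])" and ?B = "path_edges (a # zs @ [b])"
  have ABF: "?A \<subseteq> F" "?B \<subseteq> F" using yz(4) c(3) by auto
  then have ABE: "?A \<subseteq> E" "?B \<subseteq> E" using F by auto
  have dAB: "distinct (a # ys @ [b])" "distinct (a # zs @ [b])" using yz(1) by auto
  \<comment> \<open>A common edge could only join \<open>a\<close> and \<open>b\<close>. Both paths
    would then be this edge, and \<open>c\<close> would have length 2.\<close>
  have AB: "?A \<inter> ?B = {}"
  proof (rule ccontr)
    assume "?A \<inter> ?B \<noteq> {}"
    then obtain e where e: "e \<in> ?A" "e \<in> ?B" by blast
    then have "e \<subseteq> set (a # ys @ [b])" "e \<subseteq> set (a # zs @ [b])"
      using Union_path_edges_subset[of "a # ys @ [b]"] Union_path_edges_subset[of "a # zs @ [b]"]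
      by (auto simp del: path_edges.simps)
    then have "e \<subseteq> {a, b}" using yz(1) by auto
    moreover have "card e = 2" using e ABE edge(2) by blast
    ultimately have "e = {a, b}"
      by (metis card_2_iff card_subset_eq finite.emptyI finite.insertI \<open>a \<noteq> b\<close>)
    then have "ys = []" "zs = []" using chord_notin_path_edges dAB e by metis+
    then show False using yz(2) c(2) by simp
  qed
  have setF: "set ys \<subseteq> \<Union>F" "set zs \<subseteq> \<Union>F"
    using Union_path_edges[of "a # ys @ [b]"] Union_path_edges[of "a # zs @ [b]"]
      Union_mono[OF ABF(1)] Union_mono[OF ABF(2)] by auto
  obtain g1 where g1: "arc g1" "pathstart g1 = p a" "pathfinish g1 = p b"
    "path_image g1 = edge_image \<gamma> ?A"
    by (rule internal_path_arc[OF dAB(1) ABE(1)])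
  obtain g2 where g2: "arc g2" "pathstart g2 = p a" "pathfinish g2 = p b"
    "path_image g2 = edge_image \<gamma> ?B"
    by (rule internal_path_arc[OF dAB(2) ABE(2)])
  have "path_image g1 \<inter> path_image g2 = {p a, p b}"
    unfolding g1 g2 by (rule disjoint_paths_Int[OF ABE AB]) (use yz(1) in auto)
  moreover have "path_image g1 \<inter> path_image g = {p a, p b}"
    unfolding g1 g by (rule disjoint_paths_Int[OF ABE(1) PE]) (use yz(1) ear ABF setF in auto)
  moreover have "path_image g2 \<inter> path_image g = {p a, p b}"
    unfolding g2 g by (rule disjoint_paths_Int[OF ABE(2) PE]) (use yz(1) ear ABF setF in auto)
  moreover have "R \<in> components (- (path_image g1 \<union> path_image g2))"
    using R(1) unfolding yz(4) g1 g2 edge_image_Un .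
  ultimately obtain R1 R2 where R12: "R1 \<in> components (- (path_image g1 \<union> path_image g))"
    "R2 \<in> components (- (path_image g2 \<union> path_image g))" "R1 \<union> R2 = R - path_image g"
    "R1 \<inter> R2 = {}"
    using theta_regions[OF g1(1) g2(1) g(1) g1(2,3) g2(2,3) g(2,3) _ _ _ _ IR] by metis
  let ?c1 = "a # ys @ b # rev ws" and ?c2 = "a # zs @ b # rev ws"
  have ce: "cycle_edges ?c1 = ?A \<union> ?P" "cycle_edges ?c2 = ?B \<union> ?P"
    by (rule cycle_edges_two_paths)+
  have d12: "distinct ?c1" "distinct ?c2" using yz(1) ear setF by auto
  \<comment> \<open>An ear without inner vertices is an edge outside \<open>F\<close>, so it is not
    parallel to a path of \<open>F\<close> that is a single edge. This gives the new cycles length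
    at least 3.\<close>
  have short: "ws \<noteq> [] \<or> us \<noteq> []" if "path_edges (a # us @ [b]) \<subseteq> F" for us
    using that ear(5) by auto
  have len: "length ?c1 \<ge> 3" "length ?c2 \<ge> 3"
    using short[OF ABF(1)] short[OF ABF(2)] by (auto simp: neq_Nil_conv)
  obtain L1 L2 where L12: "L = L1 @ (c, R) # L2" using cR(1) by (meson split_list)
  let ?L = "(?c1, R1) # (?c2, R2) # L1 @ L2"
  have cardF: "card (F \<union> ?P) = card F + length ws + 1"
    using card_Un_disjoint[OF finF, of ?P] card_path_edges[OF ear(1)] ear(5) by fastforce
  have finU: "finite (\<Union>F)"
    using F edge(1) simple finite_subset[of "\<Union>F" V] by (auto simp: simple_graph_def)
  have "\<Union> (F \<union> ?P) = \<Union>F \<union> set ws" using UP ear by auto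
  then have cardU: "card (\<Union> (F \<union> ?P)) = card (\<Union>F) + length ws"
    using card_Un_disjoint[OF finU, of "set ws"] ear distinct_card[of ws] by auto
  have "face_system \<gamma> (F \<union> ?P) ?L"
    unfolding face_system_def
  proof (intro conjI)
    show "length ?L + card (\<Union> (F \<union> ?P)) = card (F \<union> ?P) + 2"
      using L unfolding face_system_def cardF cardU L12 by simp
    show "sum_list (map (length \<circ> fst) ?L) = 2 * card (F \<union> ?P)"
      using L yz(2) unfolding face_system_def cardF L12 by simp
    show "- edge_image \<gamma> (F \<union> ?P) \<subseteq> \<Union> (snd ` set ?L)"
    proof
      fix x assume x: "x \<in> - edge_image \<gamma> (F \<union> ?P)"
      then have "x \<in> \<Union> (snd ` set L)"
        using L unfolding face_system_def edge_image_Un by blast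
      moreover have "x \<notin> path_image g" using x unfolding g edge_image_Un by blast
      ultimately show "x \<in> \<Union> (snd ` set ?L)"
        using R12(3) unfolding L12 by auto
    qed
    have new: "R1 \<inter> edge_image \<gamma> (F \<union> ?P) = {}" "R2 \<inter> edge_image \<gamma> (F \<union> ?P) = {}"
      using R12(3) R(2) unfolding edge_image_Un g(4)[symmetric] by blast+
    have comp: "R1 \<in> components (- edge_image \<gamma> (cycle_edges ?c1))"
      "R2 \<in> components (- edge_image \<gamma> (cycle_edges ?c2))"
      using R12(1,2) unfolding ce edge_image_Un g g1 g2 by blast+
    have Lprop: "distinct d \<and> length d \<ge> 3 \<and> cycle_edges d \<subseteq> F \<and>
        S \<in> components (- edge_image \<gamma> (cycle_edges d)) \<and> S \<inter> edge_image \<gamma> F = {}"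
      if "(d, S) \<in> set L" for d S
      using L that unfolding face_system_def by blast
    have sorted: "sorted_wrt (\<lambda>x y. snd x \<inter> snd y = {}) L"
      using L unfolding face_system_def by blast
    have SR: "S \<inter> R = {}" if "(d, S) \<in> set (L1 @ L2)" for d S
    proof -
      have "\<forall>x\<in>set (L1 @ L2). R \<inter> snd x = {}"
        using sorted unfolding L12 sorted_wrt_append by (auto simp: Int_commute)
      from this[rule_format, OF that] show ?thesis by (simp add: Int_commute)
    qed
    \<comment> \<open>The remaining regions miss the ear: its open arc lies in \<open>R\<close>,
      which is disjoint from them, and its ends lie on \<open>F\<close>.\<close>
    have old: "S \<inter> edge_image \<gamma> (F \<union> ?P) = {}" if S: "(d, S) \<in> set (L1 @ L2)" for d S
    proof -
      have "S \<inter> edge_image \<gamma> F = {}" using Lprop[of d S] S unfolding L12 by auto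
      moreover from this have "p a \<notin> S" "p b \<notin> S" using vF by blast+
      then have "S \<inter> path_image g = {}" using SR[OF S] IR by blast
      ultimately show ?thesis unfolding edge_image_Un g(4)[symmetric] by blast
    qed
    have "distinct d \<and> length d \<ge> 3 \<and> cycle_edges d \<subseteq> F \<union> ?P \<and>
        S \<in> components (- edge_image \<gamma> (cycle_edges d)) \<and> S \<inter> edge_image \<gamma> (F \<union> ?P) = {}"
      if dS: "(d, S) \<in> set ?L" for d S
    proof -
      consider "d = ?c1" "S = R1" | "d = ?c2" "S = R2" | "(d, S) \<in> set (L1 @ L2)"
        using dS by auto
      then show ?thesis
      proof cases
        case 1
        then show ?thesis using d12(1) len(1) comp(1) new(1) ce(1) ABF(1) by blast
      next
        case 2
        then show ?thesis using d12(2) len(2) comp(2) new(2) ce(2) ABF(2) by blast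
      next
        case 3
        then have "(d, S) \<in> set L" unfolding L12 by auto
        then show ?thesis using Lprop[of d S] old[OF 3] by blast
      qed
    qed
    then show "\<forall>(c, R)\<in>set ?L. distinct c \<and> length c \<ge> 3 \<and> cycle_edges c \<subseteq> F \<union> ?P \<and>
        R \<in> components (- edge_image \<gamma> (cycle_edges c)) \<and> R \<inter> edge_image \<gamma> (F \<union> ?P) = {}"
      by blast
    have "R1 \<inter> S = {}" "R2 \<inter> S = {}" if "(d, S) \<in> set (L1 @ L2)" for d S
      using SR[OF that] R12(3) by blast+
    moreover have "sorted_wrt (\<lambda>x y. snd x \<inter> snd y = {}) (L1 @ L2)"
      using sorted unfolding L12 sorted_wrt_append by auto
    ultimately show "sorted_wrt (\<lambda>x y. snd x \<inter> snd y = {}) ?L"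
      using R12(4) by (simp add: ball_Un split_paired_Ball_Sigma) (metis prod.collapse)
  qed
  then show ?thesis by blast
qed

text \<open>An ear on a single edge closes a first cycle. A subgraph with the most edges among those
  that have a face system is the whole graph, since otherwise another ear could be added.\<close>

lemma nonseparable_face_system:
  assumes "nonseparable V E" "E \<noteq> {}" "\<And>e. E \<noteq> {e}"
  shows "\<exists>L. face_system \<gamma> E L"
proof -
  obtain e where e: "e \<in> E" using assms(2) by blast
  obtain a ws b where ear: "distinct (a # ws @ [b])" "a \<in> \<Union>{e}" "b \<in> \<Union>{e}"
    "path_edges (a # ws @ [b]) \<subseteq> E - {e}"
    by (rule ear_exists[OF simple assms(1), of "{e}"]) (use e assms(3) in auto)
  have "e = {a, b}"
    using ear(1-3) edge(2)[OF e] by (auto simp: card_2_iff)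
  define Q where "Q F \<longleftrightarrow> F \<subseteq> E \<and> F \<noteq> {} \<and> (\<exists>L. face_system \<gamma> F L)" for F
  have "Q (path_edges (a # ws @ [b]) \<union> {{a, b}})"
    using face_system_cycle[of a b ws] ear e unfolding Q_def \<open>e = {a, b}\<close> by auto
  moreover have "\<forall>F. Q F \<longrightarrow> card F \<le> card E"
    using card_mono[OF finite_edges] by (auto simp: Q_def)
  ultimately obtain F where F: "Q F" "\<And>F'. Q F' \<Longrightarrow> card F' \<le> card F"
    using ex_has_greatest_nat[of Q _ card "Suc (card E)"] by (metis le_imp_less_Suc)
  have "F = E"
  proof (rule ccontr)
    assume "F \<noteq> E"
    obtain a ws b where ear: "distinct (a # ws @ [b])" "a \<in> \<Union>F" "b \<in> \<Union>F" "set ws \<inter> \<Union>F = {}"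
      "path_edges (a # ws @ [b]) \<subseteq> E - F"
      by (rule ear_exists[OF simple assms(1), of F]) (use F \<open>F \<noteq> E\<close> in \<open>auto simp: Q_def\<close>)
    have "Q (F \<union> path_edges (a # ws @ [b]))"
      using face_system_ear[OF _ _ ear] F(1) ear(5) unfolding Q_def by blast
    then have "card (F \<union> path_edges (a # ws @ [b])) \<le> card F" by (rule F(2))
    moreover have "finite F" using F(1) finite_edges finite_subset unfolding Q_def by blast
    then have "card (F \<union> path_edges (a # ws @ [b])) = card F + card (path_edges (a # ws @ [b]))"
      using ear(5) by (intro card_Un_disjoint) auto
    ultimately show False using card_path_edges[OF ear(1)] by simp
  qed
  then show ?thesis using F(1) by (simp add: Q_def)
qed

text \<open>With \<open>f\<close> faces, Euler's formula gives
  \<open>f \<ge> card E + 2 - card V\<close>, and faces of length at least 5 give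
  \<open>5 * f \<le> 2 * card E\<close>.\<close>

lemma nonseparable_edge_bound:
  assumes "nonseparable V E" "E \<noteq> {}" "\<And>e. E \<noteq> {e}" and cyc: "\<And>c. is_cycle E c \<Longrightarrow> length c \<ge> 5"
  shows "3 * card E + 10 \<le> 5 * card V"
proof -
  obtain L where L: "face_system \<gamma> E L" using nonseparable_face_system[OF assms(1-3)] by blast
  have "5 \<le> (length \<circ> fst) x" if "x \<in> set L" for x
  proof -
    obtain c R where x: "x = (c, R)" by (cases x)
    then have "is_cycle E c"
      using L that by (intro is_cycle_if_cycle_edges) (auto simp: face_system_def)
    then show ?thesis using cyc x by simp
  qed
  then have "5 * length L \<le> sum_list (map (length \<circ> fst) L)"
    by (induction L) (auto, fastforce)
  moreover have "card (\<Union>E) \<le> card V"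
    using simple edge(1) by (intro card_mono) (auto simp: simple_graph_def)
  ultimately show ?thesis using L unfolding face_system_def by linarith
qed

end

section \<open>Sparsity of planar graphs of girth at least five\<close>

lemma drawn_graph_induced:
  assumes "drawn_graph V E p \<gamma>" "W \<subseteq> V"
  shows "drawn_graph W {e \<in> E. e \<subseteq> W} p \<gamma>"
proof -
  interpret drawn_graph V E p \<gamma> by fact
  have WW: "path_image (\<gamma> e) \<inter> p ` W = p ` e" if "e \<in> E" "e \<subseteq> W" for e
    using arc_edge(3)[OF that(1)] that assms(2) by blast
  show ?thesis
  proof
    show "simple_graph W {e \<in> E. e \<subseteq> W}"
      using simple assms(2) finite_subset by (auto simp: simple_graph_def)
    have "path_image (\<gamma> e) \<inter> path_image (\<gamma> f) \<subseteq> p ` W"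
      if "e \<in> E" "e \<subseteq> W" "f \<in> E" "f \<subseteq> W" "e \<noteq> f" for e f
      using edge_image_Int[of "{e}" "{f}"] that by (auto simp: edge_image_def)
    then show "plane_drawing W {e \<in> E. e \<subseteq> W} p \<gamma>"
      using arc_edge WW inj_on_subset[OF inj assms(2)] unfolding plane_drawing_def by simp
  qed
qed

text \<open>The constant 5 makes the bound additive: two parts glued at one vertex give
  \<open>3 * m + 10 \<le> 5 * (n + 1)\<close> for \<open>m\<close> edges and \<open>n\<close>
  vertices, which is the bound again. A single vertex attains equality, a single edge satisfies the
  bound, and the remaining nonseparable graphs satisfy it with 10 in place of 5.\<close>

lemma planar_girth5_sparse:
  assumes G: "simple_graph V E" "planar_graph V E" "girth E \<ge> 5" and W: "W \<subseteq> V" "W \<noteq> {}"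
  shows "3 * card {e \<in> E. e \<subseteq> W} + 5 \<le> 5 * card W"
proof -
  obtain p \<gamma> where "plane_drawing V E p \<gamma>" using G(2) by (auto simp: planar_graph_def)
  then have dg: "drawn_graph V E p \<gamma>" using G(1) by unfold_locales
  have cyc: "5 \<le> length c" if "is_cycle E c" for c
  proof -
    have "girth E \<le> enat (length c)" using that unfolding girth_def by (blast intro: Inf_lower)
    then have "5 \<le> enat (length c)" using G(3) by (rule order_trans[rotated])
    then show ?thesis by (simp add: numeral_eq_enat)
  qed
  have finV: "finite V" using G(1) by (simp add: simple_graph_def)
  show ?thesis using W
  proof (induction "card W" arbitrary: W rule: less_induct)
    case less
    let ?E = "\<lambda>W. {e \<in> E. e \<subseteq> W}"
    have finW: "finite W" using less.prems finV finite_subset by blast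
    interpret dW: drawn_graph W "?E W" p \<gamma> by (rule drawn_graph_induced[OF dg less.prems(1)])
    have "card W \<noteq> 0" using finW less.prems by simp
    consider "?E W = {}" | e where "?E W = {e}" | "nonseparable W (?E W)" "?E W \<noteq> {}"
      "\<And>e. ?E W \<noteq> {e}"
      | "\<not> nonseparable W (?E W)" by blast
    then show ?case
    proof cases
      case 1
      then show ?thesis using \<open>card W \<noteq> 0\<close> by (simp only: card.empty)
    next
      case (2 e)
      then have "e \<in> ?E W" by simp
      then have "e \<subseteq> W" "card e = 2" by (rule dW.edge)+
      then have "2 \<le> card W" using card_mono[OF finW] by metis
      then show ?thesis using 2 by simp
    next
      case 3
      have "5 \<le> length c" if "is_cycle (?E W) c" for c
        using that cyc[of c] by (auto simp: is_cycle_def)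
      from dW.nonseparable_edge_bound[OF 3 this] show ?thesis by simp
    next
      case 4
      then obtain A B where AB: "A \<union> B = W" "?E W \<subseteq> Pow A \<union> Pow B" "card (A \<inter> B) \<le> 1" "A \<noteq> W"
        "B \<noteq> W"
        unfolding nonseparable_def by blast
      have fin: "finite A" "finite B" using AB(1) finW by auto
      have "card A < card W" "card B < card W" "A \<noteq> {}" "B \<noteq> {}"
        using AB finW by (auto intro!: psubset_card_mono)
      then have "3 * card (?E A) + 5 \<le> 5 * card A" "3 * card (?E B) + 5 \<le> 5 * card B"
        using less.hyps[of A] less.hyps[of B] AB(1) less.prems(1) by auto
      moreover have "card (?E W) \<le> card (?E A) + card (?E B)"
      proof -
        have "?E W \<subseteq> ?E A \<union> ?E B" using AB(2) by auto
        moreover have "finite (?E A \<union> ?E B)"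
          using AB(1) by (intro finite_subset[OF _ dW.finite_edges]) auto
        ultimately have "card (?E W) \<le> card (?E A \<union> ?E B)" by (rule card_mono[rotated])
        also have "\<dots> \<le> card (?E A) + card (?E B)" by (rule card_Un_le)
        finally show ?thesis .
      qed
      moreover have "card A + card B = card W + card (A \<inter> B)"
        using card_Un_Int[OF fin] AB(1) by simp
      ultimately show ?thesis using AB(3) by linarith
    qed
  qed
qed

theorem theorem15:
  fixes V :: "'a set" and E :: "'a set set"
  assumes "simple_graph V E"
  shows "(planar_graph V E \<and> girth E \<ge> 5 \<longrightarrow> corr_packing_number V E \<le> 4) \<and>
         (triangle_free E \<and> max_avg_degree V E < 10 / 3 \<longrightarrow> corr_packing_number V E \<le> 4)"
proof (intro conjI impI; elim conjE)
  assume planar: "planar_graph V E" "girth E \<ge> 5"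
  have "3 * card {e \<in> E. e \<subseteq> W} < 5 * card W" if "W \<subseteq> V" "W \<noteq> {}" for W
    using planar_girth5_sparse[OF assms planar that] by linarith
  then show "corr_packing_number V E \<le> 4"
    by (rule corr_packing_number_le_4[OF assms triangle_free_if_girth[OF assms planar(2)]])
next
  assume "triangle_free E" "max_avg_degree V E < 10 / 3"
  then show "corr_packing_number V E \<le> 4"
    using corr_packing_number_le_4[OF assms] sparse_if_max_avg_degree[OF assms] by blast
qed

end
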